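(* Let $G$ be a finite digraph and let $K$ be a field of characteristic zero. For any coalgebra map $f$ from $\mathcal S_G$ to $\mathcal S_G$ (extended linearly to $K\langle \mathcal S_G\rangle$), the $\ast$-logarithm $\log_\ast f$ maps $\mathcal S_G$ into $\mathcal P_G$ (that is, $K\langle\mathcal S_G\rangle$ into $K\langle \mathcal P_G\rangle$). In particular $\log_\ast \mathrm{id}_{\mathcal S_G}$, the $\ast$-logarithm of the identity on $\mathcal S_G$, is the projector onto $\mathcal P_G$ (by linearity, it projects $K\langle\mathcal S_G\rangle$ onto $K\langle \mathcal P_G\rangle$). Moreover, in the algebra $(K\langle\mathcal S_G\rangle,\ast)$, $$\log_{\ast}\sum_{h\in \mathcal S_G}h=\sum_{p\in \mathcal{P}_G}p.$$ Equivalently, $$\log_{\ast}\big(\mathrm{perm}(\mathsf{I}+\mathsf{W})\big)=-\log_{\ast}\big(\det(\mathsf{I}-\mathsf{W})\big)=\Pi[G],\qquad \text{where } \Pi[G]=\sum_{p\in\mathcal P_G}p .$$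
   Context: Hikes: $G$ is a finite digraph, possibly with loops. To each edge $(v_i,v_j)$ is attached a formal variable $\omega_{ij}$, with $\omega_{ij}:=0$ for non-edges; the variables satisfy $\omega_{ij}\omega_{i'j'}=\omega_{i'j'}\omega_{ij}$ whenever $i\ne i'$. $\mathsf W=(\omega_{ij})$ is the labeled adjacency matrix of $G$ and $\mathsf I$ the identity matrix. A simple cycle is a closed walk of length $\ell\ge1$ visiting each of its $\ell$ vertices exactly once, up to the choice of starting vertex, identified with the product of its edges. The monoid $\mathcal H$ of hikes is the trace monoid generated by the simple cycles, in which two simple cycles commute exactly when they are vertex-disjoint; its identity $1$ is the empty hike. $V(h)$ is the set of vertices visited by $h$. A hike is self-avoiding if it is a product of pairwise vertex-disjoint simple cycles (including the empty product). $\mathcal S_G$ is the finite set of self-avoiding hikes on $G$, and $\mathcal P_G\subseteq\mathcal S_G$ is the set of all simple cycles (primes) on $G$, of any length. $K\langle\mathcal S_G\rangle$ and $K\langle \mathcal P_G\rangle$ are the sets of $K$-linear combinations of elements of $\mathcal S_G$ and of $\mathcal P_G$. Permanents and determinants are the usual sums over permutations; each term is, up to a scalar, the product of the simple cycles formed by the chosen edges, so they are elements of $K\langle\mathcal S_G\rangle$. Structure: on $K\langle\mathcal S_G\rangle$ the bilinear product $\ast$ is given on self-avoiding hikes by $h\ast h'=hh'$ if $V(h)\cap V(h')=\emptyset$ and $h\ast h'=0$ otherwise, with unit $1$. The coalgebra structure is $\epsilon(h)=1$ if $h=1$ and $0$ otherwise, and $\Delta(h)=\sum_{d\mid h,\ V(d)\cap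 V(h/d)=\emptyset} d\otimes \frac hd$, where $d\mid h$ means $h=dd'$ for a hike $d'=:h/d$. Logarithms: for linear endomorphisms $f,g$ of $K\langle\mathcal S_G\rangle$, the convolution is $(f\ast g)(h)=\sum_{d\mid h,\ V(d)\cap V(h/d)=\emptyset} f(d)\ast g(h/d)$, with identity element $u:h\mapsto\epsilon(h)1$, and $\log_\ast f=\sum_{k\ge1}\frac{(-1)^{k-1}}{k}(f-u)^{\ast k}$. For $\alpha\in K\langle\mathcal S_G\rangle$ with constant coefficient (coefficient of the empty hike) equal to $1$, $\log_\ast\alpha=\sum_{k\ge1}\frac{(-1)^{k-1}}{k}(\alpha-1)^{\ast k}$, powers being taken for the product $\ast$ of $K\langle\mathcal S_G\rangle$. *)

theory Defs
  imports
    "HOL-Library.Poly_Mapping"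
    "HOL-Combinatorics.Permutations"
    "Graph_Theory.Pair_Digraph"
begin

section \<open>Trace monoids\<close>

class indep =
  fixes indep :: "'a \<Rightarrow> 'a \<Rightarrow> bool"
  assumes indep_sym: "indep a b \<Longrightarrow> indep b a"

definition swap_step :: "'a::indep list \<Rightarrow> 'a list \<Rightarrow> bool" where
  "swap_step u v \<longleftrightarrow> (\<exists>x y a b. indep a b \<and> u = x @ [a, b] @ y \<and> v = x @ [b, a] @ y)"

definition trace_eq :: "'a::indep list \<Rightarrow> 'a list \<Rightarrow> bool" where
  "trace_eq = equivclp swap_step"

lemma swap_stepI: "indep a b \<Longrightarrow> swap_step (x @ a # b # y) (x @ b # a # y)"
  unfolding swap_step_def by (rule exI, rule exI, rule exI[of _ a], rule exI[of _ b]) simp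

lemma swap_stepE:
  assumes "swap_step u v"
  obtains x y a b where "indep a b" "u = x @ a # b # y" "v = x @ b # a # y"
proof -
  from assms obtain x y a b where "indep a b \<and> u = x @ [a, b] @ y \<and> v = x @ [b, a] @ y"
    unfolding swap_step_def by (elim exE)
  then show ?thesis by (intro that[of a b x y]) simp_all
qed

lemma swap_step_append:
  assumes "swap_step u v"
  shows "swap_step (x @ u @ y) (x @ v @ y)"
  using assms
proof (rule swap_stepE)
  fix p q a b
  assume "indep a b" "u = p @ a # b # q" "v = p @ b # a # q"
  then show ?thesis using swap_stepI[of a b "x @ p" "q @ y"] by simp
qed

lemma trace_eq_context: "trace_eq u v \<Longrightarrow> trace_eq (x @ u @ y) (x @ v @ y)"
  unfolding trace_eq_def
proof (induction rule: equivclp_induct)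
  case (step v w)
  from step(2) have "swap_step (x @ v @ y) (x @ w @ y) \<or> swap_step (x @ w @ y) (x @ v @ y)"
    by (auto intro: swap_step_append)
  with step(3) show ?case by (rule equivclp_into_equivclp)
qed simp

lemma trace_eq_append: "trace_eq u u' \<Longrightarrow> trace_eq v v' \<Longrightarrow> trace_eq (u @ v) (u' @ v')"
proof -
  assume u: "trace_eq u u'" and v: "trace_eq v v'"
  have "trace_eq (u @ v) (u' @ v)" using trace_eq_context[OF u, of "[]" v] by simp
  moreover have "trace_eq (u' @ v) (u' @ v')" using trace_eq_context[OF v, of u' "[]"] by simp
  ultimately show ?thesis unfolding trace_eq_def by (rule equivclp_trans)
qed

lemma trace_eq_set: "trace_eq u v \<Longrightarrow> set u = set v"
  unfolding trace_eq_def
proof (induction rule: equivclp_induct)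
  case (step v w)
  from step(2) have "set v = set w" by (auto elim!: swap_stepE)
  with step(3) show ?case by simp
qed simp

quotient_type (overloaded) 'a trace = "'a::indep list" / trace_eq
  unfolding trace_eq_def
proof (rule equivpI)
  show "symp (equivclp swap_step)" by (rule sympI) (rule equivclp_sym)
  show "transp (equivclp swap_step)" by (rule transpI) (rule equivclp_trans)
qed (simp add: reflp_def)

text \<open>The monoid is written additively (although it is not commutative), with the empty
  trace as \<open>0\<close>: with this convention \<^typ>\<open>'a::indep trace \<Rightarrow>\<^sub>0 'k::field\<close> with the library's
  product is the monoid algebra.\<close>

instantiation trace :: (indep) monoid_add
begin

lift_definition zero_trace :: "'a trace" is "[]" .

lift_definition plus_trace :: "'a trace \<Rightarrow> 'a trace \<Rightarrow> 'a trace" is "(@)"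
  by (rule trace_eq_append)

instance
  by standard (transfer, simp add: trace_eq_def)+

end

lift_definition gen :: "'a::indep \<Rightarrow> 'a trace" is "\<lambda>a. [a]" .

lift_definition letters :: "'a::indep trace \<Rightarrow> 'a set" is set
  by (rule trace_eq_set)

definition tdvd :: "'a::indep trace \<Rightarrow> 'a trace \<Rightarrow> bool" where
  "tdvd d h \<longleftrightarrow> (\<exists>d'. h = d + d')"

text \<open>Meaningful when \<^term>\<open>tdvd d h\<close>; trace monoids are cancellative.\<close>

definition tquot :: "'a::indep trace \<Rightarrow> 'a trace \<Rightarrow> 'a trace" where
  "tquot h d = (THE d'. h = d + d')"

lemma abs_trace_sum_list: "abs_trace w = sum_list (map gen w)"
proof (induction w)
  case Nil
  show ?case by (simp add: zero_trace_def)
next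
  case (Cons a w)
  have "abs_trace (a # w) = gen a + abs_trace w" by (simp add: gen.abs_eq plus_trace.abs_eq)
  with Cons show ?case by simp
qed

lemma gen_commute:
  assumes "indep a b"
  shows "gen a + gen b = gen b + gen a"
proof -
  have "swap_step ([a] @ [b]) ([b] @ [a])"
    using swap_stepI[OF assms, of "[]" "[]"] by simp
  then have "trace_eq ([a] @ [b]) ([b] @ [a])" unfolding trace_eq_def by (rule r_into_equivclp)
  then show ?thesis unfolding gen.abs_eq plus_trace.abs_eq trace.abs_eq_iff .
qed

section \<open>Simple cycles and hikes\<close>

text \<open>A simple cycle, as in Graph\_Theory, is a closed arc list; two such lists are
  identified when they differ by the choice of the starting vertex. The type collects the simple
  cycles of the complete digraph with loops on the vertex type.\<close>

abbreviation complete_digraph :: "'v pair_pre_digraph" where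
  "complete_digraph \<equiv> \<lparr> pverts = UNIV, parcs = UNIV \<rparr>"

definition same_cycle :: "('v \<times> 'v) list \<Rightarrow> ('v \<times> 'v) list \<Rightarrow> bool" where
  "same_cycle p q \<longleftrightarrow> pre_digraph.cycle (with_proj complete_digraph) p
     \<and> pre_digraph.cycle (with_proj complete_digraph) q \<and> (\<exists>n. q = rotate n p)"

lemma rotate_inverse: "\<exists>m. p = rotate m (rotate n p)"
proof (cases "p = []")
  case False
  let ?l = "length p"
  have "rotate (?l - n mod ?l) (rotate n p) = rotate ((?l - n mod ?l + n) mod ?l) p"
    by (simp add: rotate_rotate) (metis rotate_conv_mod)
  also have "(?l - n mod ?l + n) mod ?l = (?l - n mod ?l + n mod ?l) mod ?l"
    by (simp add: mod_add_right_eq)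
  also have "\<dots> = 0" using False by (simp add: less_imp_le)
  finally show ?thesis by (metis rotate0 id_apply)
qed simp

lemma same_cycle_part_equivp: "part_equivp same_cycle"
proof (rule part_equivpI)
  have "pre_digraph.cycle (with_proj complete_digraph) [(undefined :: 'v, undefined)]"
    by (simp add: pre_digraph.cycle_def pre_digraph.awalk_def pre_digraph.cas.simps
        pre_digraph.awalk_verts.simps)
  then show "\<exists>p :: ('v \<times> 'v) list. same_cycle p p"
    unfolding same_cycle_def by (metis rotate0 id_apply)
  show "symp (same_cycle :: ('v \<times> 'v) list \<Rightarrow> _)"
    by (rule sympI) (use rotate_inverse in \<open>auto simp: same_cycle_def\<close>)
  show "transp (same_cycle :: ('v \<times> 'v) list \<Rightarrow> _)"
    by (rule transpI) (auto simp: same_cycle_def rotate_rotate)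
qed

quotient_type 'v scycle = "('v \<times> 'v) list" / partial: same_cycle
  by (rule same_cycle_part_equivp)

lift_definition cycle_verts :: "'v scycle \<Rightarrow> 'v set" is "\<lambda>p. fst ` set p \<union> snd ` set p"
  by (auto simp: same_cycle_def)

instantiation scycle :: (type) indep
begin

definition indep_scycle :: "'a scycle \<Rightarrow> 'a scycle \<Rightarrow> bool" where
  "indep_scycle c c' \<longleftrightarrow> cycle_verts c \<inter> cycle_verts c' = {}"

instance
  by standard (auto simp: indep_scycle_def)

end

type_synonym 'v hike = "'v scycle trace"

definition hike_verts :: "'v hike \<Rightarrow> 'v set" where
  "hike_verts h = (\<Union>c\<in>letters h. cycle_verts c)"

definition simple_cycles :: "'v pair_pre_digraph \<Rightarrow> 'v scycle set" where
  "simple_cycles G = abs_scycle ` {p. pre_digraph.cycle (with_proj G) p}"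

definition primes :: "'v pair_pre_digraph \<Rightarrow> 'v hike set" where
  "primes G = gen ` simple_cycles G"

definition self_avoiding :: "'v pair_pre_digraph \<Rightarrow> 'v hike set" where
  "self_avoiding G = {sum_list (map gen cs) |cs. set cs \<subseteq> simple_cycles G
     \<and> sorted_wrt (\<lambda>c c'. cycle_verts c \<inter> cycle_verts c' = {}) cs}"

section \<open>The algebra and coalgebra of self-avoiding hikes\<close>

definition lincombs :: "'h set \<Rightarrow> ('h \<Rightarrow>\<^sub>0 'k::field) set" where
  "lincombs B = {x. Poly_Mapping.keys x \<subseteq> B}"

definition scale :: "'k::field \<Rightarrow> ('h \<Rightarrow>\<^sub>0 'k) \<Rightarrow> 'h \<Rightarrow>\<^sub>0 'k" where
  "scale c = Poly_Mapping.map ((*) c)"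

abbreviation basis :: "'h \<Rightarrow> 'h \<Rightarrow>\<^sub>0 'k::field" where
  "basis h \<equiv> Poly_Mapping.single h 1"

definition lin_ext :: "('g \<Rightarrow> 'h \<Rightarrow>\<^sub>0 'k::field) \<Rightarrow> ('g \<Rightarrow>\<^sub>0 'k) \<Rightarrow> 'h \<Rightarrow>\<^sub>0 'k" where
  "lin_ext \<phi> x = (\<Sum>h\<in>Poly_Mapping.keys x. scale (Poly_Mapping.lookup x h) (\<phi> h))"

definition linear_on_set :: "('g \<Rightarrow>\<^sub>0 'k::field) set \<Rightarrow> (('g \<Rightarrow>\<^sub>0 'k) \<Rightarrow> 'h \<Rightarrow>\<^sub>0 'k) \<Rightarrow> bool" where
  "linear_on_set U F \<longleftrightarrow> (\<forall>x\<in>U. \<forall>y\<in>U. F (x + y) = F x + F y)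
     \<and> (\<forall>c. \<forall>x\<in>U. F (scale c x) = scale c (F x))"

definition star :: "('v hike \<Rightarrow>\<^sub>0 'k::field) \<Rightarrow> ('v hike \<Rightarrow>\<^sub>0 'k) \<Rightarrow> 'v hike \<Rightarrow>\<^sub>0 'k" where
  "star x y = lin_ext (\<lambda>h. lin_ext (\<lambda>h'.
     if hike_verts h \<inter> hike_verts h' = {} then basis (h + h') else 0) y) x"

definition counit :: "('v hike \<Rightarrow>\<^sub>0 'k::field) \<Rightarrow> 'k" where
  "counit x = Poly_Mapping.lookup x 0"

definition disjoint_divisors :: "'v hike \<Rightarrow> 'v hike set" where
  "disjoint_divisors h = {d. tdvd d h \<and> hike_verts d \<inter> hike_verts (tquot h d) = {}}"

text \<open>The tensor product of two spaces with given bases is realised as the space with basis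
  the pairs of basis elements.\<close>

definition tensor :: "('g \<Rightarrow>\<^sub>0 'k::field) \<Rightarrow> ('h \<Rightarrow>\<^sub>0 'k) \<Rightarrow> 'g \<times> 'h \<Rightarrow>\<^sub>0 'k" where
  "tensor x y = lin_ext (\<lambda>a. lin_ext (\<lambda>b. basis (a, b)) y) x"

definition tensor_map ::
  "(('a \<Rightarrow>\<^sub>0 'k::field) \<Rightarrow> 'c \<Rightarrow>\<^sub>0 'k) \<Rightarrow> (('b \<Rightarrow>\<^sub>0 'k) \<Rightarrow> 'd \<Rightarrow>\<^sub>0 'k)
     \<Rightarrow> ('a \<times> 'b \<Rightarrow>\<^sub>0 'k) \<Rightarrow> 'c \<times> 'd \<Rightarrow>\<^sub>0 'k" where
  "tensor_map f g = lin_ext (\<lambda>(a, b). tensor (f (basis a)) (g (basis b)))"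

definition comult :: "('v hike \<Rightarrow>\<^sub>0 'k::field) \<Rightarrow> 'v hike \<times> 'v hike \<Rightarrow>\<^sub>0 'k" where
  "comult = lin_ext (\<lambda>h. \<Sum>d\<in>disjoint_divisors h. tensor (basis d) (basis (tquot h d)))"

definition coalgebra_map ::
  "'v pair_pre_digraph \<Rightarrow> (('v hike \<Rightarrow>\<^sub>0 'k::field) \<Rightarrow> 'v hike \<Rightarrow>\<^sub>0 'k) \<Rightarrow> bool" where
  "coalgebra_map G f \<longleftrightarrow> linear_on_set (lincombs (self_avoiding G)) f
     \<and> (\<forall>x\<in>lincombs (self_avoiding G). f x \<in> lincombs (self_avoiding G)
          \<and> counit (f x) = counit x
          \<and> comult (f x) = tensor_map f f (comult x))"

section \<open>Logarithms\<close>

text \<open>In both series the terms vanish from some point on whenever \<open>f 1 = 1\<close> (which holds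
  for every coalgebra map, \<open>1\<close> being the only element with \<open>\<Delta> g = g \<otimes> g\<close> and \<open>\<epsilon> g = 1\<close>), respectively
  the constant coefficient is \<open>1\<close>, since at most \<open>|V|\<close> nonempty hikes can be pairwise disjoint;
  \<^const>\<open>Sum_any\<close> is the sum over the finitely many indices with a nonzero term. The
  summation index is shifted by one.\<close>

definition conv ::
  "(('v hike \<Rightarrow>\<^sub>0 'k::field) \<Rightarrow> 'v hike \<Rightarrow>\<^sub>0 'k) \<Rightarrow> (('v hike \<Rightarrow>\<^sub>0 'k) \<Rightarrow> 'v hike \<Rightarrow>\<^sub>0 'k)
     \<Rightarrow> ('v hike \<Rightarrow>\<^sub>0 'k) \<Rightarrow> 'v hike \<Rightarrow>\<^sub>0 'k" where
  "conv f g = lin_ext (\<lambda>h. \<Sum>d\<in>disjoint_divisors h. star (f (basis d)) (g (basis (tquot h d))))"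

definition conv_unit :: "('v hike \<Rightarrow>\<^sub>0 'k::field) \<Rightarrow> 'v hike \<Rightarrow>\<^sub>0 'k" where
  "conv_unit x = scale (counit x) (basis 0)"

definition conv_log ::
  "(('v hike \<Rightarrow>\<^sub>0 'k::field_char_0) \<Rightarrow> 'v hike \<Rightarrow>\<^sub>0 'k) \<Rightarrow> ('v hike \<Rightarrow>\<^sub>0 'k) \<Rightarrow> 'v hike \<Rightarrow>\<^sub>0 'k" where
  "conv_log f x = Sum_any (\<lambda>k. scale ((- 1) ^ k / of_nat (Suc k))
     ((conv (\<lambda>y. f y - conv_unit y) ^^ Suc k) conv_unit x))"

definition star_log :: "('v hike \<Rightarrow>\<^sub>0 'k::field_char_0) \<Rightarrow> 'v hike \<Rightarrow>\<^sub>0 'k" where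
  "star_log a = Sum_any (\<lambda>k. scale ((- 1) ^ k / of_nat (Suc k))
     ((star (a - basis 0) ^^ Suc k) (basis 0)))"

definition projector_onto ::
  "('h \<Rightarrow>\<^sub>0 'k::field) set \<Rightarrow> ('h \<Rightarrow>\<^sub>0 'k) set \<Rightarrow> (('h \<Rightarrow>\<^sub>0 'k) \<Rightarrow> 'h \<Rightarrow>\<^sub>0 'k) \<Rightarrow> bool" where
  "projector_onto U W F \<longleftrightarrow> linear_on_set U F \<and> F ` U = W \<and> (\<forall>x\<in>U. F (F x) = F x)"

section \<open>The labeled adjacency matrix\<close>

datatype 'v edge_var = Omega 'v 'v

instantiation edge_var :: (type) indep
begin

fun indep_edge_var :: "'a edge_var \<Rightarrow> 'a edge_var \<Rightarrow> bool" where
  "indep_edge_var (Omega i j) (Omega i' j') \<longleftrightarrow> i \<noteq> i'"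

instance
proof
  fix a b :: "'a edge_var"
  show "indep a b \<Longrightarrow> indep b a" by (cases a; cases b) auto
qed

end

lemma sum_list_gen_commute:
  assumes "\<And>a b. a \<in> set u \<Longrightarrow> b \<in> set v \<Longrightarrow> indep a b"
  shows "sum_list (map gen u) + sum_list (map gen v) = sum_list (map gen v) + sum_list (map gen u)"
proof -
  have one: "gen a + sum_list (map gen w) = sum_list (map gen w) + gen a"
    if "\<forall>b\<in>set w. indep a b" for a and w :: "'a list"
    using that
  proof (induction w)
    case (Cons b w)
    then have "gen a + gen b = gen b + gen a" by (intro gen_commute) simp
    then have "gen a + sum_list (map gen (b # w)) = gen b + (gen a + sum_list (map gen w))"
      by (simp flip: add.assoc)
    also have "gen a + sum_list (map gen w) = sum_list (map gen w) + gen a"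
      using Cons by simp
    finally show ?case by (simp add: add.assoc)
  qed simp
  show ?thesis using assms
  proof (induction u)
    case (Cons a u)
    have "sum_list (map gen (a # u)) + sum_list (map gen v)
        = gen a + (sum_list (map gen u) + sum_list (map gen v))"
      by (simp add: add.assoc)
    also have "sum_list (map gen u) + sum_list (map gen v) = sum_list (map gen v) + sum_list (map gen u)"
      using Cons by simp
    also have "gen a + (sum_list (map gen v) + sum_list (map gen u))
        = (gen a + sum_list (map gen v)) + sum_list (map gen u)"
      by (simp add: add.assoc)
    also have "gen a + sum_list (map gen v) = sum_list (map gen v) + gen a"
      using Cons.prems by (intro one) simp
    finally show ?case by (simp add: add.assoc)
  qed simp
qed

lemma cycle_distinct_tails:
  assumes "pre_digraph.cycle (with_proj G) p"
  shows "distinct (map fst p)"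
proof -
  obtain u where cas: "pcas u p u" and d: "distinct (tl (pawalk_verts u p))" and ne: "p \<noteq> []"
    using assms
    by (auto simp: pre_digraph.cycle_def pre_digraph.awalk_def cas_with_proj_eq
        awalk_verts_with_proj_eq)
  have "pawalk_verts u p = map fst p @ [v]" if "pcas u p v" for u v
    using that by (induction p arbitrary: u) auto
  with cas have eq: "pawalk_verts u p = map fst p @ [u]" by blast
  from ne cas obtain e q where p: "p = e # q" and "fst e = u" by (cases p) auto
  with d eq show ?thesis by auto
qed

text \<open>The product of the edges of a simple cycle, read from any starting vertex.\<close>

lift_definition cycle_edges :: "'v scycle \<Rightarrow> 'v edge_var trace" is "map (\<lambda>(i, j). Omega i j)"
proof -
  fix p q :: "('v \<times> 'v) list"
  assume pq: "same_cycle p q"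
  let ?f = "\<lambda>(i, j). Omega i j"
  have d: "distinct (map fst p)" using pq cycle_distinct_tails by (auto simp: same_cycle_def)
  obtain n where q: "q = rotate n p" using pq by (auto simp: same_cycle_def)
  let ?m = "n mod length p"
  have q': "q = drop ?m p @ take ?m p" using q by (simp add: rotate_drop_take)
  have "distinct (map fst (take ?m p) @ map fst (drop ?m p))"
    using d by (metis append_take_drop_id map_append)
  then have disj: "fst ` set (take ?m p) \<inter> fst ` set (drop ?m p) = {}"
    by (simp only: distinct_append set_map)
  have "indep a b" if "a \<in> set (map ?f (take ?m p))" "b \<in> set (map ?f (drop ?m p))" for a b
  proof -
    from that obtain e e' where e: "e \<in> set (take ?m p)" "a = ?f e"
      and e': "e' \<in> set (drop ?m p)" "b = ?f e'"
      by (auto simp only: set_map)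
    with disj have "fst e \<noteq> fst e'" by blast
    with e(2) e'(2) show ?thesis by (cases e; cases e') simp
  qed
  then have "abs_trace (map ?f (take ?m p)) + abs_trace (map ?f (drop ?m p))
      = abs_trace (map ?f (drop ?m p)) + abs_trace (map ?f (take ?m p))"
    unfolding abs_trace_sum_list by (rule sum_list_gen_commute)
  then have "abs_trace (map ?f p) = abs_trace (map ?f q)"
    unfolding q' plus_trace.abs_eq by (simp flip: map_append)
  then show "trace_eq (map ?f p) (map ?f q)" by (simp add: trace.abs_eq_iff)
qed

text \<open>Extended multiplicatively to hikes; the lemma shows that the choice of the word
  representing a hike is immaterial.\<close>

definition hike_edges :: "'v hike \<Rightarrow> 'v edge_var trace" where
  "hike_edges h = sum_list (map cycle_edges (rep_trace h))"

lemma cycle_edges_commute: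
  assumes "indep c c'"
  shows "cycle_edges c + cycle_edges c' = cycle_edges c' + cycle_edges c"
proof -
  let ?f = "\<lambda>(i, j). Omega i j"
  obtain p where p: "c = abs_scycle p" "same_cycle p p"
    by (metis Quotient_scycle Quotient_abs_rep Quotient_rep_reflp)
  obtain q where q: "c' = abs_scycle q" "same_cycle q q"
    by (metis Quotient_scycle Quotient_abs_rep Quotient_rep_reflp)
  have disj: "fst ` set p \<inter> fst ` set q = {}"
    using assms p q by (auto simp: indep_scycle_def cycle_verts.abs_eq)
  have "indep a b" if "a \<in> set (map ?f p)" "b \<in> set (map ?f q)" for a b
  proof -
    from that obtain e e' where e: "e \<in> set p" "a = ?f e" and e': "e' \<in> set q" "b = ?f e'"
      by (auto simp only: set_map)
    with disj have "fst e \<noteq> fst e'" by blast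
    with e(2) e'(2) show ?thesis by (cases e; cases e') simp
  qed
  then show ?thesis
    unfolding p(1) q(1) cycle_edges.abs_eq[OF p(2)] cycle_edges.abs_eq[OF q(2)] abs_trace_sum_list
    by (rule sum_list_gen_commute)
qed

lemma hike_edges_sum_list: "hike_edges (sum_list (map gen cs)) = sum_list (map cycle_edges cs)"
proof -
  have "sum_list (map cycle_edges u) = sum_list (map cycle_edges v)" if "trace_eq u v"
    for u v :: "'a scycle list"
    using that unfolding trace_eq_def
  proof (induction rule: equivclp_induct)
    case (step v w)
    have "sum_list (map cycle_edges v) = sum_list (map cycle_edges w)" if "swap_step v w"
      for v w :: "'a scycle list"
      using that
    proof (rule swap_stepE)
      fix x y a b
      assume ab: "indep a b" and v: "v = x @ a # b # y" and w: "w = x @ b # a # y"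
      have "cycle_edges a + (cycle_edges b + s) = cycle_edges b + (cycle_edges a + s)" for s
        using cycle_edges_commute[OF ab] by (simp flip: add.assoc)
      then show ?thesis by (simp add: v w)
    qed
    with step show ?case by metis
  qed simp
  moreover have "trace_eq (rep_trace (abs_trace cs)) cs"
    by (metis Quotient_trace Quotient_abs_rep trace.abs_eq_iff)
  ultimately show ?thesis by (simp add: hike_edges_def flip: abs_trace_sum_list)
qed

text \<open>The linear map from hikes to noncommutative polynomials in the edge variables along which
  hikes are identified with products of edges.\<close>

definition to_edges :: "('v hike \<Rightarrow>\<^sub>0 'k::field) \<Rightarrow> 'v edge_var trace \<Rightarrow>\<^sub>0 'k" where
  "to_edges = lin_ext (\<lambda>h. basis (hike_edges h))"

definition adj_matrix :: "'v pair_pre_digraph \<Rightarrow> 'v \<Rightarrow> 'v \<Rightarrow> ('v edge_var trace \<Rightarrow>\<^sub>0 'k::field)" where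
  "adj_matrix G i j = (if (i, j) \<in> parcs G then basis (gen (Omega i j)) else 0)"

definition id_matrix :: "'v \<Rightarrow> 'v \<Rightarrow> 'r::ring_1" where
  "id_matrix i j = (if i = j then 1 else 0)"

text \<open>Permanent and determinant of a matrix indexed by \<open>V\<close> in which entries in different rows
  commute, so that the product over the rows does not depend on the order of multiplication.\<close>

definition row_prod :: "'v set \<Rightarrow> ('v \<Rightarrow> 'v \<Rightarrow> 'r::ring_1) \<Rightarrow> ('v \<Rightarrow> 'v) \<Rightarrow> 'r" where
  "row_prod V A \<sigma> = Finite_Set.fold (\<lambda>i. (*) (A i (\<sigma> i))) 1 V"

definition perm_on :: "'v set \<Rightarrow> ('v \<Rightarrow> 'v \<Rightarrow> 'r::ring_1) \<Rightarrow> 'r" where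
  "perm_on V A = (\<Sum>\<sigma> | \<sigma> permutes V. row_prod V A \<sigma>)"

definition det_on :: "'v set \<Rightarrow> ('v \<Rightarrow> 'v \<Rightarrow> 'r::ring_1) \<Rightarrow> 'r" where
  "det_on V A = (\<Sum>\<sigma> | \<sigma> permutes V. of_int (sign \<sigma>) * row_prod V A \<sigma>)"

definition perm_I_plus_W :: "'v pair_pre_digraph \<Rightarrow> 'v edge_var trace \<Rightarrow>\<^sub>0 'k::field" where
  "perm_I_plus_W G = perm_on (pverts G) (\<lambda>i j. id_matrix i j + adj_matrix G i j)"

definition det_I_minus_W :: "'v pair_pre_digraph \<Rightarrow> 'v edge_var trace \<Rightarrow>\<^sub>0 'k::field" where
  "det_I_minus_W G = det_on (pverts G) (\<lambda>i j. id_matrix i j - adj_matrix G i j)"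

text \<open>The element of the span of the self-avoiding hikes represented by a polynomial in the edge
  variables.\<close>

definition as_hikes ::
  "'v pair_pre_digraph \<Rightarrow> ('v edge_var trace \<Rightarrow>\<^sub>0 'k::field) \<Rightarrow> 'v hike \<Rightarrow>\<^sub>0 'k" where
  "as_hikes G = inv_into (lincombs (self_avoiding G)) to_edges"

definition prime_sum :: "'v pair_pre_digraph \<Rightarrow> 'v hike \<Rightarrow>\<^sub>0 'k::field" where
  "prime_sum G = (\<Sum>p\<in>primes G. basis p)"

end

theory Submission
  imports
    Defs
    "HOL-Combinatorics.Cycles"
    "HOL-Computational_Algebra.Formal_Power_Series"
begin

text \<open>
A self-avoiding hike is the product of a finite set \<open>C\<close> of pairwise disjoint simple cycles, and
\<open>C\<close> can be read off from the hike as its set of letters. Under this identification the product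
\<open>\<ast>\<close> is disjoint union of sets (or \<open>0\<close>) and the coproduct sums over the ways of splitting a set in
two. All logarithms in the theorem then reduce to the formal identity \<open>log (exp t) = t\<close>, as follows.

Let \<open>u\<close> be the unit of convolution. Expanding \<open>(id - u) \<ast> \<dots> \<ast> (id - u)\<close> on the hike \<open>h\<close> with set of
cycles \<open>C\<close> gives one copy of \<open>h\<close> for every ordered partition of \<open>C\<close> into \<open>k\<close> nonempty blocks, so
\<open>(id - u)\<^sup>k h = N(|C|, k) h\<close>, where \<open>N(n, k)\<close> is the number of surjections from an \<open>n\<close>-set onto a
\<open>k\<close>-set (\<open>conv_power_id\<close>). Since \<open>N(n, k) / n!\<close> is the coefficient of \<open>t\<^sup>n\<close> in \<open>(exp t - 1)\<^sup>k\<close>, the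
alternating sum of the \<open>N(n, k) / k\<close> is \<open>n!\<close> times the coefficient of \<open>t\<^sup>n\<close> in \<open>log (exp t) = t\<close>, that
is, \<open>1\<close> for \<open>n = 1\<close> and \<open>0\<close> otherwise (\<open>log_surjection_count\<close>). Hence the logarithm of the identity
keeps the hikes with exactly one cycle and kills the others: it is the projector onto the primes.

For a coalgebra map \<open>f\<close>, precomposition with \<open>f\<close> is multiplicative for convolution
(\<open>conv_coalgebra_map\<close>), and \<open>u \<circ> f = u\<close>. Therefore \<open>(f - u)\<^sup>k = (id - u)\<^sup>k \<circ> f\<close>, and the logarithm of
\<open>f\<close> is the logarithm of the identity composed with \<open>f\<close>; its values are combinations of primes
(\<open>conv_log_coalgebra_map\<close>).

The same count applies in the algebra to \<open>\<Sum> a\<^bsup>|C|\<^esup> h\<close>, the sum over all self-avoiding hikes, for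
any scalar \<open>a\<close>: the product of two hikes carries the product of their weights, so the \<open>k\<close>-th power of
this sum minus \<open>1\<close> is \<open>\<Sum> a\<^bsup>|C|\<^esup> N(|C|, k) h\<close>, and the logarithm is \<open>a\<close> times the sum of the primes
(\<open>star_log_weighted_hike_sum\<close>).

The case \<open>a = 1\<close> is the sum of all self-avoiding hikes, which is also \<open>perm(I + W)\<close>, and \<open>a = -1\<close> is
\<open>det(I - W)\<close>. To see this, expand the product over the rows belonging to a permutation: every term
chooses a set \<open>S\<close> of rows that use an edge, the other rows contributing the diagonal \<open>1\<close>, so that the
permutation is a permutation \<open>\<sigma>\<close> of \<open>S\<close>. The cycle decomposition of \<open>\<sigma>\<close>, fixed points being loops,
matches the pairs \<open>(S, \<sigma>)\<close> with the families \<open>C\<close> of disjoint cycles covering \<open>S\<close>, and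
\<open>sign \<sigma> (-1)\<^bsup>|S|\<^esup> = (-1)\<^bsup>|C|\<^esup>\<close> because a cycle of length \<open>l\<close> has sign \<open>(-1)\<^bsup>l - 1\<^esup>\<close>
(\<open>sum_permutations_expand\<close>). Passing to products of edges loses nothing: a family of disjoint
cycles is determined by its set of edges, in which every vertex has at most one outgoing edge and
hence lies on at most one cycle (\<open>family_arcs_inj\<close>).
\<close>

section \<open>Products of pairwise commuting letters in a trace monoid\<close>

text \<open>The set of letters alone does not tell apart traces with repeated letters. The multiset of letters
is the invariant from which every factor of a product of distinct commuting letters is recovered.\<close>

lemma trace_eq_mset: "trace_eq u v \<Longrightarrow> mset u = mset v"
  unfolding trace_eq_def
proof (induction rule: equivclp_induct)
  case (step v w)
  from step(2) have "mset v = mset w" by (auto elim!: swap_stepE)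
  with step(3) show ?case by simp
qed simp

lift_definition trace_mset :: "'a::indep trace \<Rightarrow> 'a multiset" is mset
  by (rule trace_eq_mset)

lemma trace_mset_simps [simp]:
  "trace_mset 0 = {#}" "trace_mset (s + t) = trace_mset s + trace_mset t"
  "trace_mset (gen a) = {#a#}"
  by (transfer, simp)+

lemma set_trace_mset: "set_mset (trace_mset t) = letters t"
  by transfer simp

lemma trace_mset_word: "trace_mset (sum_list (map gen xs)) = mset xs"
  by (induction xs) auto

lemma letters_simps [simp]:
  "letters 0 = {}" "letters (s + t) = letters s \<union> letters t" "letters (gen a) = {a}"
  by (simp_all flip: set_trace_mset)

lemma letters_word: "letters (sum_list (map gen xs)) = set xs"
  by (simp add: trace_mset_word flip: set_trace_mset)

lemma trace_cases:
  obtains w where "t = sum_list (map gen w)"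
  by (metis Quotient_trace Quotient_abs_rep abs_trace_sum_list)

lemma word_cong:
  assumes "pairwise indep (set u)" "distinct u" "distinct v" "set u = set v"
  shows "sum_list (map gen u) = sum_list (map gen v)"
  using assms
proof (induction u arbitrary: v)
  case (Cons a u)
  then obtain x y where v: "v = x @ a # y" by (metis list.set_intros(1) split_list)
  have "indep b c" if "b \<in> set x" "c \<in> set [a]" for b c
    using Cons.prems that unfolding v pairwise_def by auto
  then have comm: "sum_list (map gen x) + gen a = gen a + sum_list (map gen x)"
    using sum_list_gen_commute[of x "[a]"] by simp
  have "sum_list (map gen u) = sum_list (map gen (x @ y))"
    by (rule Cons.IH) (use Cons.prems in \<open>auto simp: v pairwise_def\<close>)
  then show ?case unfolding v using comm by (simp flip: add.assoc)
qed simp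

text \<open>The product of a finite set of letters, taken in some arbitrary order; the order matters unless the
letters commute pairwise. Applied to cycles it gives the self-avoiding hikes, applied to edge
variables the monomials of the permanent.\<close>

definition trace_prod :: "'a::indep set \<Rightarrow> 'a trace" where
  "trace_prod A = sum_list (map gen (SOME xs. distinct xs \<and> set xs = A))"

lemma trace_prod_set:
  assumes "pairwise indep (set xs)" "distinct xs"
  shows "trace_prod (set xs) = sum_list (map gen xs)"
proof -
  have "distinct (SOME ys. distinct ys \<and> set ys = set xs) \<and> set (SOME ys. distinct ys \<and> set ys = set xs) = set xs"
    by (rule someI[of _ xs]) (use assms in simp)
  then show ?thesis unfolding trace_prod_def by (intro word_cong) (use assms in auto)
qed

lemma trace_prod_empty [simp]: "trace_prod {} = 0"
  using trace_prod_set[of "[]"] by simp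

lemma trace_prod_singleton [simp]: "trace_prod {a} = gen a"
  using trace_prod_set[of "[a]"] by simp

lemma letters_trace_prod: "finite A \<Longrightarrow> letters (trace_prod A) = A"
  unfolding trace_prod_def letters_word
  by (metis (mono_tags, lifting) finite_distinct_list someI_ex)

lemma trace_prod_Un:
  assumes "finite A" "finite B" "pairwise indep (A \<union> B)" "A \<inter> B = {}"
  shows "trace_prod (A \<union> B) = trace_prod A + trace_prod B"
proof -
  obtain xs ys where xs: "set xs = A" "distinct xs" and ys: "set ys = B" "distinct ys"
    using assms finite_distinct_list by metis
  have "pairwise indep A" "pairwise indep B"
    using assms(3) by (auto simp: pairwise_def)
  then show ?thesis
    using assms trace_prod_set[of "xs @ ys"] trace_prod_set[of xs] trace_prod_set[of ys] xs ys by simp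
qed

lemma trace_prod_insert:
  assumes "finite A" "pairwise indep (insert a A)" "a \<notin> A"
  shows "trace_prod (insert a A) = gen a + trace_prod A"
  using trace_prod_Un[of "{a}" A] assms by simp

text \<open>The letters of \<open>s\<close> and \<open>t\<close> together are those of \<open>A\<close>, each occurring once, so both factors are again
products of commuting letters and are determined by their sets of letters. This gives at once the
divisors of \<open>trace_prod A\<close> and the uniqueness of the quotients.\<close>

lemma trace_prod_eq_plus:
  assumes "finite A" "pairwise indep A" "trace_prod A = s + t"
  shows "letters s \<subseteq> A" "s = trace_prod (letters s)" "t = trace_prod (A - letters s)"
proof -
  obtain xs where xs: "set xs = A" "distinct xs" using assms finite_distinct_list by metis
  obtain u where u: "s = sum_list (map gen u)" by (rule trace_cases)
  obtain v where v: "t = sum_list (map gen v)" by (rule trace_cases)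
  have "sum_list (map gen xs) = s + t"
    using assms xs trace_prod_set[of xs] by simp
  then have m: "mset xs = mset (u @ v)"
    by (metis trace_mset_word trace_mset_simps(2) mset_append u v)
  then have d: "distinct (u @ v)" "set (u @ v) = A"
    using xs mset_eq_imp_distinct_iff mset_eq_setD by metis+
  have pw: "pairwise indep (set u)" "pairwise indep (set v)"
    using d(2) assms(2) unfolding pairwise_def by auto
  have l: "letters s = set u" unfolding u letters_word ..
  have v': "set v = A - letters s" using d unfolding l by auto
  show "letters s \<subseteq> A" using d l by auto
  show "s = trace_prod (letters s)" using trace_prod_set[OF pw(1)] d l u by simp
  show "t = trace_prod (A - letters s)" unfolding v'[symmetric] using trace_prod_set[OF pw(2)] d v by simp
qed

lemma trace_prod_split:
  assumes "finite A" "pairwise indep A" "D \<subseteq> A"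
  shows "trace_prod A = trace_prod D + trace_prod (A - D)"
proof -
  have "D \<union> (A - D) = A" using assms(3) by auto
  with assms show ?thesis
    using trace_prod_Un[of D "A - D"] by (simp add: finite_subset)
qed

lemma tdvd_trace_prod:
  assumes "finite A" "pairwise indep A"
  shows "tdvd d (trace_prod A) \<longleftrightarrow> (\<exists>D\<subseteq>A. d = trace_prod D)"
  using trace_prod_eq_plus[OF assms] trace_prod_split[OF assms] unfolding tdvd_def by metis

lemma tquot_trace_prod:
  assumes "finite A" "pairwise indep A" "D \<subseteq> A"
  shows "tquot (trace_prod A) (trace_prod D) = trace_prod (A - D)"
  unfolding tquot_def
proof (rule the_equality)
  show "trace_prod A = trace_prod D + trace_prod (A - D)" by (rule trace_prod_split[OF assms])
next
  fix t assume "trace_prod A = trace_prod D + t"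
  from trace_prod_eq_plus(3)[OF assms(1,2) this] show "t = trace_prod (A - D)"
    using letters_trace_prod[of D] assms finite_subset by metis
qed

section \<open>Linear maps between spaces with a basis\<close>

lemma lookup_scale [simp]: "Poly_Mapping.lookup (scale c x) h = c * Poly_Mapping.lookup x h"
  unfolding scale_def by (simp add: Poly_Mapping.map.rep_eq when_def)

lemma scale_simps [simp]:
  "scale c 0 = 0" "scale 0 x = 0" "scale 1 x = x" "scale c (scale d x) = scale (c * d) x"
  by (rule poly_mapping_eqI, simp)+

lemma scale_single: "scale c (Poly_Mapping.single h a) = Poly_Mapping.single h (c * a)"
  by (rule poly_mapping_eqI) (simp add: lookup_single when_def)

lemma scale_add: "scale c (x + y) = scale c x + scale c y"
  by (rule poly_mapping_eqI) (simp add: lookup_add algebra_simps)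

lemma scale_diff: "scale c (x - y) = scale c x - scale c y"
  by (rule poly_mapping_eqI) (simp add: lookup_minus algebra_simps)

lemma scale_left_add: "scale (c + d) x = scale c x + scale d x"
  by (rule poly_mapping_eqI) (simp add: lookup_add algebra_simps)

lemma scale_minus_one: "scale (- 1) x = - x"
  by (rule poly_mapping_eqI) simp

lemma linearI:
  assumes "\<And>x y. F (x + y) = F x + F y" "\<And>c x. F (scale c x) = scale c (F x)"
  shows "linear_on_set UNIV F"
  using assms unfolding linear_on_set_def by blast

lemma linearD:
  assumes "linear_on_set UNIV F"
  shows "F (x + y) = F x + F y" "F (scale c x) = scale c (F x)"
  using assms unfolding linear_on_set_def by blast+

lemma linear_zero:
  assumes "linear_on_set UNIV F"
  shows "F 0 = 0"
  using linearD(2)[OF assms, of 0 0] by simp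

lemma linear_sum:
  assumes "linear_on_set UNIV F"
  shows "F (sum g A) = (\<Sum>i\<in>A. F (g i))"
  by (induction A rule: infinite_finite_induct)
    (simp_all add: linear_zero[OF assms] linearD(1)[OF assms])

lemma linear_id: "linear_on_set UNIV id"
  by (rule linearI) simp_all

lemma linear_scale: "linear_on_set UNIV (scale c)"
  by (rule linearI) (simp_all add: scale_add mult.commute)

lemma linear_diff:
  assumes "linear_on_set UNIV F" "linear_on_set UNIV H"
  shows "linear_on_set UNIV (\<lambda>x. F x - H x)"
  by (rule linearI) (simp_all add: linearD[OF assms(1)] linearD[OF assms(2)] scale_diff)

lemma linear_compose:
  assumes "linear_on_set UNIV F" "linear_on_set UNIV H"
  shows "linear_on_set UNIV (\<lambda>x. F (H x))"
  by (rule linearI) (simp_all add: linearD[OF assms(1)] linearD[OF assms(2)])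

lemma linear_sum_maps:
  assumes "\<And>i. i \<in> A \<Longrightarrow> linear_on_set UNIV (F i)"
  shows "linear_on_set UNIV (\<lambda>x. \<Sum>i\<in>A. F i x)"
  using assms
proof (induction A rule: infinite_finite_induct)
  case (insert i A)
  then have "linear_on_set UNIV (F i)" "linear_on_set UNIV (\<lambda>x. \<Sum>i\<in>A. F i x)" by simp_all
  from linearD[OF this(1)] linearD[OF this(2)] insert.hyps show ?case
    by (intro linearI) (simp_all add: scale_add)
qed (rule linearI; simp)+

lemma basis_expansion: "x = (\<Sum>h\<in>Poly_Mapping.keys x. scale (Poly_Mapping.lookup x h) (basis h))"
  by (rule poly_mapping_eqI)
    (auto simp: lookup_sum lookup_single when_def in_keys_iff sum.If_cases if_distrib cong: if_cong)

text \<open>The principle by which all identities between linear maps are checked: on the basis elements that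
occur in the argument.\<close>

lemma linear_eqI:
  assumes "linear_on_set UNIV F" "linear_on_set UNIV H"
    and "\<And>h. h \<in> Poly_Mapping.keys x \<Longrightarrow> F (basis h) = H (basis h)"
  shows "F x = H x"
proof -
  have *: "K x = (\<Sum>h\<in>Poly_Mapping.keys x. scale (Poly_Mapping.lookup x h) (K (basis h)))"
    if "linear_on_set UNIV K" for K :: "('a \<Rightarrow>\<^sub>0 'b) \<Rightarrow> 'c \<Rightarrow>\<^sub>0 'b"
    by (subst basis_expansion) (simp add: linear_sum[OF that] linearD(2)[OF that])
  show ?thesis unfolding *[OF assms(1)] *[OF assms(2)] using assms(3) by simp
qed

lemma lin_ext_superset:
  assumes "finite A" "Poly_Mapping.keys x \<subseteq> A"
  shows "lin_ext \<phi> x = (\<Sum>h\<in>A. scale (Poly_Mapping.lookup x h) (\<phi> h))"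
  unfolding lin_ext_def by (rule sum.mono_neutral_left) (use assms in \<open>auto simp: in_keys_iff\<close>)

lemma linear_lin_ext:
  fixes \<phi> :: "'g \<Rightarrow> 'h \<Rightarrow>\<^sub>0 'k::field"
  shows "linear_on_set UNIV (lin_ext \<phi>)"
proof (rule linearI)
  fix x y :: "'g \<Rightarrow>\<^sub>0 'k"
  let ?A = "Poly_Mapping.keys x \<union> Poly_Mapping.keys y"
  have "lin_ext \<phi> (x + y) = (\<Sum>h\<in>?A. scale (Poly_Mapping.lookup (x + y) h) (\<phi> h))"
    by (rule lin_ext_superset) (auto intro: finite_UnI simp: Poly_Mapping.keys_add)
  also have "\<dots> = (\<Sum>h\<in>?A. scale (Poly_Mapping.lookup x h) (\<phi> h))
      + (\<Sum>h\<in>?A. scale (Poly_Mapping.lookup y h) (\<phi> h))"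
    by (simp add: lookup_add scale_left_add sum.distrib)
  also have "\<dots> = lin_ext \<phi> x + lin_ext \<phi> y"
    by (simp add: lin_ext_superset[of ?A])
  finally show "lin_ext \<phi> (x + y) = lin_ext \<phi> x + lin_ext \<phi> y" .
next
  fix c and x :: "'g \<Rightarrow>\<^sub>0 'k"
  have "lin_ext \<phi> (scale c x) = (\<Sum>h\<in>Poly_Mapping.keys x. scale (Poly_Mapping.lookup (scale c x) h) (\<phi> h))"
    by (rule lin_ext_superset) (auto simp: in_keys_iff)
  then show "lin_ext \<phi> (scale c x) = scale c (lin_ext \<phi> x)"
    by (simp add: lin_ext_def linear_sum[OF linear_scale])
qed

lemma lin_ext_basis [simp]: "lin_ext \<phi> (basis h) = \<phi> h"
  by (simp add: lin_ext_def)

lemma linear_lin_ext_param: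
  assumes "\<And>h. linear_on_set UNIV (\<phi> h)"
  shows "linear_on_set UNIV (\<lambda>y. lin_ext (\<lambda>h. \<phi> h y) x)"
  unfolding lin_ext_def
  by (intro linear_sum_maps linear_compose[OF linear_scale] assms)

lemma linear_star_left: "linear_on_set UNIV (\<lambda>x. star x y)"
  unfolding star_def by (rule linear_lin_ext)

lemma linear_star_right: "linear_on_set UNIV (star x)"
  unfolding star_def by (intro linear_lin_ext_param linear_lin_ext)

lemma star_basis:
  "star (basis h) (basis h') = (if hike_verts h \<inter> hike_verts h' = {} then basis (h + h') else 0)"
  by (simp add: star_def)

lemma star_single:
  "star (Poly_Mapping.single h c) (Poly_Mapping.single h' d)
    = (if hike_verts h \<inter> hike_verts h' = {} then Poly_Mapping.single (h + h') (c * d) else 0)"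
  using linearD(2)[OF linear_star_left, of c "basis h" "Poly_Mapping.single h' d"]
    linearD(2)[OF linear_star_right, of "basis h" d "basis h'"]
  by (simp add: scale_single star_basis)

lemma linear_tensor_left: "linear_on_set UNIV (\<lambda>x. tensor x y)"
  unfolding tensor_def by (rule linear_lin_ext)

lemma linear_tensor_right: "linear_on_set UNIV (tensor x)"
  unfolding tensor_def by (intro linear_lin_ext_param linear_lin_ext)

lemma tensor_basis [simp]: "tensor (basis a) (basis b) = basis (a, b)"
  by (simp add: tensor_def)

lemma linear_conv_unit: "linear_on_set UNIV conv_unit"
  by (rule linearI) (simp_all add: conv_unit_def counit_def lookup_add scale_left_add)

lemma conv_unit_basis: "conv_unit (basis h) = (if h = 0 then basis 0 else 0)"
  by (simp add: conv_unit_def counit_def lookup_single when_def)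

lemma linear_conv: "linear_on_set UNIV (conv f g)"
  unfolding conv_def by (rule linear_lin_ext)

section \<open>Convolution and coalgebra maps\<close>

text \<open>The composite of \<open>f \<otimes> g\<close> with the multiplication. Convolution is this map after the coproduct, which
separates the role of the coproduct from that of the two maps.\<close>

definition star_tensor ::
  "(('a \<Rightarrow>\<^sub>0 'k::field) \<Rightarrow> 'v hike \<Rightarrow>\<^sub>0 'k) \<Rightarrow> (('b \<Rightarrow>\<^sub>0 'k) \<Rightarrow> 'v hike \<Rightarrow>\<^sub>0 'k)
     \<Rightarrow> ('a \<times> 'b \<Rightarrow>\<^sub>0 'k) \<Rightarrow> 'v hike \<Rightarrow>\<^sub>0 'k" where
  "star_tensor f g = lin_ext (\<lambda>(a, b). star (f (basis a)) (g (basis b)))"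

lemma linear_star_tensor: "linear_on_set UNIV (star_tensor f g)"
  unfolding star_tensor_def by (rule linear_lin_ext)

lemma conv_eq_star_tensor: "conv f g x = star_tensor f g (comult x)"
proof (rule linear_eqI[OF linear_conv, where H = "\<lambda>x. star_tensor f g (comult x)"])
  show "linear_on_set UNIV (\<lambda>x. star_tensor f g (comult x))"
    unfolding comult_def by (rule linear_compose[OF linear_star_tensor linear_lin_ext])
  show "conv f g (basis h) = star_tensor f g (comult (basis h))" for h
    unfolding conv_def comult_def lin_ext_basis linear_sum[OF linear_star_tensor] tensor_basis
    unfolding star_tensor_def lin_ext_basis by simp
qed

lemma star_tensor_tensor:
  assumes "linear_on_set UNIV f" "linear_on_set UNIV g"
  shows "star_tensor f g (tensor x y) = star (f x) (g y)"
proof (rule linear_eqI[where F = "\<lambda>x. star_tensor f g (tensor x y)" and H = "\<lambda>x. star (f x) (g y)"])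
  show "linear_on_set UNIV (\<lambda>x. star_tensor f g (tensor x y))"
    by (rule linear_compose[OF linear_star_tensor linear_tensor_left])
  show "linear_on_set UNIV (\<lambda>x. star (f x) (g y))"
    by (rule linear_compose[OF linear_star_left assms(1)])
next
  fix a
  show "star_tensor f g (tensor (basis a) y) = star (f (basis a)) (g y)"
  proof (rule linear_eqI[where F = "\<lambda>y. star_tensor f g (tensor (basis a) y)" and H = "\<lambda>y. star (f (basis a)) (g y)"])
    show "linear_on_set UNIV (\<lambda>y. star_tensor f g (tensor (basis a) y))"
      by (rule linear_compose[OF linear_star_tensor linear_tensor_right])
    show "linear_on_set UNIV (\<lambda>y. star (f (basis a)) (g y))"
      by (rule linear_compose[OF linear_star_right assms(2)])
    show "star_tensor f g (tensor (basis a) (basis b)) = star (f (basis a)) (g (basis b))" for b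
      by (simp add: star_tensor_def)
  qed
qed

lemma star_tensor_tensor_map:
  fixes f :: "('a \<Rightarrow>\<^sub>0 'k::field) \<Rightarrow> 'c \<Rightarrow>\<^sub>0 'k"
    and g :: "('b \<Rightarrow>\<^sub>0 'k) \<Rightarrow> 'd \<Rightarrow>\<^sub>0 'k"
  assumes "linear_on_set UNIV \<phi>" "linear_on_set UNIV \<psi>"
  shows "star_tensor \<phi> \<psi> (tensor_map f g t) = star_tensor (\<lambda>x. \<phi> (f x)) (\<lambda>x. \<psi> (g x)) t"
proof (rule linear_eqI[OF _ linear_star_tensor, where F = "\<lambda>t. star_tensor \<phi> \<psi> (tensor_map f g t)"])
  show "linear_on_set UNIV (\<lambda>t. star_tensor \<phi> \<psi> (tensor_map f g t))"
    unfolding tensor_map_def by (rule linear_compose[OF linear_star_tensor linear_lin_ext])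
  fix p :: "'a \<times> 'b"
  obtain a b where p: "p = (a, b)" by (cases p)
  show "star_tensor \<phi> \<psi> (tensor_map f g (basis p)) = star_tensor (\<lambda>x. \<phi> (f x)) (\<lambda>x. \<psi> (g x)) (basis p)"
    using star_tensor_tensor[OF assms] by (simp add: p tensor_map_def star_tensor_def)
qed

text \<open>A coalgebra map can be moved through the coproduct, so precomposition with it respects
convolution.\<close>

lemma conv_coalgebra_map:
  assumes "coalgebra_map G f" "x \<in> lincombs (self_avoiding G)"
    and "linear_on_set UNIV \<phi>" "linear_on_set UNIV \<psi>"
  shows "conv \<phi> \<psi> (f x) = conv (\<lambda>y. \<phi> (f y)) (\<lambda>y. \<psi> (f y)) x"
proof -
  have "comult (f x) = tensor_map f f (comult x)"
    using assms(1,2) by (simp add: coalgebra_map_def)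
  then show ?thesis
    by (simp add: conv_eq_star_tensor star_tensor_tensor_map[OF assms(3,4)])
qed

lemma conv_cong:
  assumes "\<And>h d. h \<in> Poly_Mapping.keys x \<Longrightarrow> d \<in> disjoint_divisors h \<Longrightarrow> f (basis d) = f' (basis d)"
    and "\<And>h d. h \<in> Poly_Mapping.keys x \<Longrightarrow> d \<in> disjoint_divisors h
      \<Longrightarrow> g (basis (tquot h d)) = g' (basis (tquot h d))"
  shows "conv f g x = conv f' g' x"
  unfolding conv_def lin_ext_def using assms by (auto intro!: sum.cong arg_cong[where f = "scale _"])

section \<open>Self-avoiding hikes and families of disjoint cycles\<close>

lemma scycle_cases:
  obtains p where "c = abs_scycle p" "same_cycle p p"
  by (metis Quotient_scycle Quotient_abs_rep Quotient_rep_reflp)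

text \<open>No cycle is independent of itself. Hence disjoint cycles in a list are distinct, and families of
disjoint cycles may be treated as sets.\<close>

lemma cycle_verts_nonempty: "cycle_verts c \<noteq> {}"
proof -
  obtain p where p: "c = abs_scycle p" "same_cycle p p" by (rule scycle_cases)
  then have "p \<noteq> []" by (auto simp: same_cycle_def pre_digraph.cycle_def)
  with p show ?thesis by (auto simp: cycle_verts.abs_eq)
qed

definition disjoint_families :: "'v pair_pre_digraph \<Rightarrow> 'v scycle set set" where
  "disjoint_families G = {C. C \<subseteq> simple_cycles G \<and> finite C \<and> pairwise indep C}"

lemma disjoint_familiesD:
  assumes "C \<in> disjoint_families G"
  shows "C \<subseteq> simple_cycles G" "finite C" "pairwise indep C"
  using assms unfolding disjoint_families_def by auto

lemma disjoint_families_subset: "C \<in> disjoint_families G \<Longrightarrow> D \<subseteq> C \<Longrightarrow> D \<in> disjoint_families G"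
  unfolding disjoint_families_def by (auto intro: finite_subset pairwise_subset)

lemma hike_verts_trace_prod: "finite C \<Longrightarrow> hike_verts (trace_prod C) = (\<Union>c\<in>C. cycle_verts c)"
  unfolding hike_verts_def by (simp add: letters_trace_prod)

text \<open>Translates the condition \<open>V(h) \<inter> V(h') = {}\<close> of the product into a condition on sets of cycles; the
union is then automatically disjoint because cycles have vertices.\<close>

lemma pairwise_indep_Un_cycles:
  fixes C D :: "'v scycle set"
  assumes "finite C" "finite D"
  shows "pairwise indep C \<and> pairwise indep D \<and> hike_verts (trace_prod C) \<inter> hike_verts (trace_prod D) = {}
    \<longleftrightarrow> pairwise indep (C \<union> D) \<and> C \<inter> D = {}"
proof -
  have irrefl: "\<not> indep c c" for c :: "'v scycle"
    using cycle_verts_nonempty by (simp add: indep_scycle_def)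
  have "hike_verts (trace_prod C) \<inter> hike_verts (trace_prod D) = {} \<longleftrightarrow> (\<forall>c\<in>C. \<forall>d\<in>D. indep c d)"
    unfolding hike_verts_trace_prod[OF assms(1)] hike_verts_trace_prod[OF assms(2)] indep_scycle_def
    by auto
  moreover have "pairwise indep (C \<union> D) \<and> C \<inter> D = {}"
    if "pairwise indep C" "pairwise indep D" "\<forall>c\<in>C. \<forall>d\<in>D. indep c d"
    using that irrefl indep_sym unfolding pairwise_def by (metis Un_iff disjoint_iff)
  moreover have "\<forall>c\<in>C. \<forall>d\<in>D. indep c d" if "pairwise indep (C \<union> D)" "C \<inter> D = {}"
    using that unfolding pairwise_def by (metis Un_iff disjoint_iff)
  moreover have "pairwise indep C" "pairwise indep D" if "pairwise indep (C \<union> D)"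
    using that by (auto intro: pairwise_subset)
  ultimately show ?thesis by blast
qed

lemma self_avoiding_eq: "self_avoiding G = trace_prod ` disjoint_families G"
proof (intro set_eqI iffI)
  fix h assume "h \<in> self_avoiding G"
  then obtain cs where h: "h = sum_list (map gen cs)" and cs: "set cs \<subseteq> simple_cycles G"
    and s: "sorted_wrt (\<lambda>c c'. cycle_verts c \<inter> cycle_verts c' = {}) cs"
    unfolding self_avoiding_def by blast
  from s have "distinct cs \<and> pairwise indep (set cs)"
  proof (induction cs)
    case (Cons c cs)
    then show ?case using cycle_verts_nonempty[of c]
      by (auto simp: pairwise_insert indep_scycle_def)
  qed simp
  with h cs show "h \<in> trace_prod ` disjoint_families G"
    unfolding disjoint_families_def by (intro image_eqI[of _ _ "set cs"]) (auto simp: trace_prod_set)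
next
  fix h assume "h \<in> trace_prod ` disjoint_families G"
  then obtain C where h: "h = trace_prod C" and C: "C \<in> disjoint_families G" by blast
  obtain cs where cs: "set cs = C" "distinct cs"
    using finite_distinct_list disjoint_familiesD(2)[OF C] by metis
  have pw: "pairwise indep (set cs)" using disjoint_familiesD(3)[OF C] cs by simp
  with cs(2) have "sorted_wrt (\<lambda>c c'. cycle_verts c \<inter> cycle_verts c' = {}) cs"
    by (induction cs) (auto simp: pairwise_insert indep_scycle_def)
  moreover have "h = sum_list (map gen cs)" using trace_prod_set[OF pw] h cs by simp
  ultimately show "h \<in> self_avoiding G"
    unfolding self_avoiding_def using disjoint_familiesD(1)[OF C] cs by blast
qed

lemma inj_on_trace_prod: "inj_on trace_prod {C. finite C}"
  by (rule inj_on_inverseI[of _ letters]) (simp add: letters_trace_prod)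

lemma inj_on_trace_prod_families: "inj_on trace_prod (disjoint_families G)"
  by (rule inj_on_subset[OF inj_on_trace_prod]) (auto simp: disjoint_families_def)

text \<open>Any two parts of a family of disjoint cycles have disjoint vertex sets, so the vertex condition in
the coproduct excludes no divisor of a self-avoiding hike.\<close>

lemma disjoint_divisors_trace_prod:
  fixes C :: "'v scycle set"
  assumes "finite C" "pairwise indep C"
  shows "disjoint_divisors (trace_prod C) = trace_prod ` Pow C"
proof -
  have "hike_verts (trace_prod D) \<inter> hike_verts (tquot (trace_prod C) (trace_prod D)) = {}" if "D \<subseteq> C" for D
  proof -
    have "D \<union> (C - D) = C" using that by blast
    then show ?thesis
      using pairwise_indep_Un_cycles[of D "C - D"] that assms tquot_trace_prod[OF assms that]
      by (simp add: finite_subset)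
  qed
  then show ?thesis
    unfolding disjoint_divisors_def tdvd_trace_prod[OF assms] by auto
qed

lemma sum_disjoint_divisors:
  fixes C :: "'v scycle set"
  assumes "finite C" "pairwise indep C"
  shows "(\<Sum>d\<in>disjoint_divisors (trace_prod C). F d (tquot (trace_prod C) d))
    = (\<Sum>D\<in>Pow C. F (trace_prod D) (trace_prod (C - D)))"
proof -
  have "inj_on trace_prod (Pow C)"
    by (rule inj_on_subset[OF inj_on_trace_prod]) (use assms finite_subset in auto)
  then show ?thesis
    unfolding disjoint_divisors_trace_prod[OF assms]
    by (simp add: sum.reindex tquot_trace_prod[OF assms])
qed

lemma disjoint_divisors_self_avoiding:
  assumes "h \<in> self_avoiding G" "d \<in> disjoint_divisors h"
  shows "d \<in> self_avoiding G" "tquot h d \<in> self_avoiding G"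
proof -
  obtain C where C: "C \<in> disjoint_families G" "h = trace_prod C"
    using assms(1) unfolding self_avoiding_eq by blast
  note fam = disjoint_familiesD[OF C(1)]
  obtain D where D: "D \<subseteq> C" "d = trace_prod D"
    using assms(2) disjoint_divisors_trace_prod[OF fam(2,3)] C(2) by auto
  show "d \<in> self_avoiding G" "tquot h d \<in> self_avoiding G"
    unfolding self_avoiding_eq C(2) D(2) tquot_trace_prod[OF fam(2,3) D(1)]
    using disjoint_families_subset[OF C(1)] D(1) by blast+
qed

lemma gen_eq_trace_prod_iff:
  assumes "finite C"
  shows "gen c = trace_prod C \<longleftrightarrow> C = {c}"
  using letters_trace_prod[OF assms] letters_simps(3) trace_prod_singleton by metis

lemma trace_prod_in_primes:
  assumes "C \<in> disjoint_families G"
  shows "trace_prod C \<in> primes G \<longleftrightarrow> card C = 1"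
proof
  assume "trace_prod C \<in> primes G"
  then obtain c where "trace_prod C = gen c" unfolding primes_def by blast
  then show "card C = 1" using gen_eq_trace_prod_iff[of C c] disjoint_familiesD(2)[OF assms] by auto
next
  assume "card C = 1"
  then obtain c where "C = {c}" by (metis card_1_singletonE)
  with disjoint_familiesD(1)[OF assms] show "trace_prod C \<in> primes G" unfolding primes_def by auto
qed

lemma primes_subset_self_avoiding: "primes G \<subseteq> self_avoiding G"
proof
  fix h assume "h \<in> primes G"
  then obtain c where "c \<in> simple_cycles G" "h = trace_prod {c}" unfolding primes_def by auto
  then show "h \<in> self_avoiding G"
    unfolding self_avoiding_eq disjoint_families_def by (intro image_eqI[of _ _ "{c}"]) auto
qed

section \<open>The exponential series and the logarithm\<close>

text \<open>The number of surjections from an \<open>n\<close>-element set onto a \<open>k\<close>-element set, in the form of its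
exponential generating function \<open>(exp t - 1)\<^sup>k\<close>; in this form \<open>log (exp t) = t\<close> can be used
directly.\<close>

definition surjection_count :: "nat \<Rightarrow> nat \<Rightarrow> 'k::field_char_0" where
  "surjection_count n k = fact n * fps_nth ((fps_exp 1 - 1) ^ k) n"

lemma surjection_count_0: "surjection_count n 0 = (if n = 0 then 1 else 0)"
  by (simp add: surjection_count_def)

lemma surjection_count_eq_0:
  assumes "n < k"
  shows "surjection_count n k = (0 :: 'k::field_char_0)"
proof -
  have "fps_nth ((fps_exp (1::'k) - 1) ^ k) n = 0"
    by (rule startsby_zero_power_prefix[rule_format]) (use assms in auto)
  then show ?thesis by (simp add: surjection_count_def)
qed

lemma sum_Pow_card:
  assumes "finite C"
  shows "(\<Sum>D\<in>Pow C. F (card D)) = (\<Sum>j\<le>card C. of_nat (card C choose j) * (F j :: 'r::semiring_1))"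
proof -
  have "(\<Sum>D\<in>Pow C. F (card D)) = (\<Sum>j\<le>card C. \<Sum>D\<in>{D\<in>Pow C. card D = j}. F (card D))"
    by (rule sum.group[symmetric]) (use assms in \<open>auto intro: card_mono\<close>)
  also have "\<dots> = (\<Sum>j\<le>card C. of_nat (card C choose j) * F j)"
    by (rule sum.cong) (simp_all add: n_subsets[OF assms])
  finally show ?thesis .
qed

text \<open>A surjection onto \<open>k + 1\<close> points amounts to the nonempty fibre \<open>D\<close> of one point and a surjection
of the complement onto the others. In terms of generating functions this is multiplication by
\<open>exp t - 1\<close>.\<close>

lemma surjection_count_Suc:
  assumes "finite C"
  shows "surjection_count (card C) (Suc k)
    = (\<Sum>D\<in>Pow C - {{}}. surjection_count (card (C - D)) k :: 'k::field_char_0)"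
proof -
  let ?n = "card C" and ?s = "fps_nth ((fps_exp (1::'k) - 1) ^ k)"
  let ?F = "\<lambda>j. if j = 0 then 0 else surjection_count (?n - j) k :: 'k"
  have "(\<Sum>D\<in>Pow C - {{}}. surjection_count (card (C - D)) k :: 'k) = (\<Sum>D\<in>Pow C. ?F (card D))"
    by (rule sum.mono_neutral_cong_left)
      (use assms in \<open>auto simp: card_Diff_subset finite_subset card_eq_0_iff\<close>)
  also have "\<dots> = (\<Sum>j\<le>?n. of_nat (?n choose j) * ?F j)"
    by (rule sum_Pow_card[OF assms])
  also have "\<dots> = (\<Sum>j\<le>?n. fact ?n * (fps_nth (fps_exp 1 - 1) j * ?s (?n - j)))"
    by (rule sum.cong) (auto simp: surjection_count_def binomial_fact)
  also have "\<dots> = fact ?n * fps_nth ((fps_exp 1 - 1) * (fps_exp 1 - 1) ^ k) ?n"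
    by (simp add: fps_mult_nth atLeast0AtMost sum_distrib_left)
  finally show ?thesis by (simp add: surjection_count_def)
qed

text \<open>Up to the factor \<open>n!\<close> this is the coefficient of \<open>t\<^sup>n\<close> in \<open>log (1 + (exp t - 1)) = t\<close>. The upper
bound \<open>m\<close> leaves room so that one bound serves all hikes of a graph.\<close>

lemma log_surjection_count:
  assumes "n \<le> m"
  shows "(\<Sum>k<m. (- 1) ^ k / of_nat (Suc k) * surjection_count n (Suc k))
    = (if n = 1 then 1 else 0 :: 'k::field_char_0)"
proof -
  let ?e = "fps_exp (1::'k) - 1"
  let ?t = "\<lambda>k. (- 1) ^ k / of_nat (Suc k) * surjection_count n (Suc k) :: 'k"
  have "(\<Sum>k<m. ?t k) = (\<Sum>k<n. ?t k)"
    by (rule sum.mono_neutral_right) (use assms in \<open>auto simp: surjection_count_eq_0\<close>)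
  also have "\<dots> = fact n * (\<Sum>k<n. fps_nth (fps_ln 1) (Suc k) * fps_nth (?e ^ Suc k) n)"
    by (simp add: sum_distrib_left surjection_count_def fps_ln_nth algebra_simps del: power_Suc of_nat_Suc)
  also have "(\<Sum>k<n. fps_nth (fps_ln 1) (Suc k) * fps_nth (?e ^ Suc k) n) = fps_nth (fps_ln 1 oo ?e) n"
    unfolding fps_compose_nth sum.atLeast0_atMost_Suc_shift atLeast0AtMost
    by (subst lessThan_Suc_atMost[symmetric], subst sum.lessThan_Suc_shift) simp
  also have "fps_ln 1 oo ?e = fps_X"
    by (simp add: fps_ln_fps_exp_inv fps_inv)
  finally show ?thesis by simp
qed

lemma sum_image_families:
  assumes "\<And>C. C \<in> disjoint_families G \<Longrightarrow> f (trace_prod C) = g C"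
  shows "(\<Sum>h\<in>self_avoiding G. f h) = (\<Sum>C\<in>disjoint_families G. g C)"
  unfolding self_avoiding_eq using assms
  by (simp add: sum.reindex[OF inj_on_trace_prod_families])

lemma trace_prod_eq_0_iff: "finite C \<Longrightarrow> trace_prod C = 0 \<longleftrightarrow> C = {}"
  using letters_trace_prod[of C] by auto

section \<open>The logarithm of the identity and of coalgebra maps\<close>

definition conv_power ::
  "(('v hike \<Rightarrow>\<^sub>0 'k::field) \<Rightarrow> 'v hike \<Rightarrow>\<^sub>0 'k) \<Rightarrow> nat \<Rightarrow> ('v hike \<Rightarrow>\<^sub>0 'k) \<Rightarrow> 'v hike \<Rightarrow>\<^sub>0 'k" where
  "conv_power f k = (conv (\<lambda>y. f y - conv_unit y) ^^ k) conv_unit"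

lemma conv_power_Suc: "conv_power f (Suc k) = conv (\<lambda>y. f y - conv_unit y) (conv_power f k)"
  by (simp add: conv_power_def)

lemma conv_log_eq:
  "conv_log f x = Sum_any (\<lambda>k. scale ((- 1) ^ k / of_nat (Suc k)) (conv_power f (Suc k) x))"
  unfolding conv_log_def conv_power_def ..

lemma linear_conv_power: "linear_on_set UNIV (conv_power f k)"
  unfolding conv_power_def by (cases k) (simp_all add: linear_conv_unit linear_conv)

text \<open>Because \<open>f\<close> preserves the counit, \<open>f - u = (id - u) \<circ> f\<close> on self-avoiding hikes, and powers follow
since precomposition with \<open>f\<close> respects convolution. Induction stays among self-avoiding hikes, as
their divisors are self-avoiding.\<close>

lemma conv_power_coalgebra_map:
  assumes f: "coalgebra_map G f" and x: "x \<in> lincombs (self_avoiding G)"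
  shows "conv_power f k x = conv_power id k (f x)"
  using x
proof (induction k arbitrary: x)
  have unit: "conv_unit (f x) = conv_unit x" if "x \<in> lincombs (self_avoiding G)" for x
    using f that by (simp add: coalgebra_map_def conv_unit_def)
  case 0
  with unit show ?case by (simp add: conv_power_def)
next
  have unit: "conv_unit (f x) = conv_unit x" if "x \<in> lincombs (self_avoiding G)" for x
    using f that by (simp add: coalgebra_map_def conv_unit_def)
  have sa: "basis h \<in> lincombs (self_avoiding G)" if "h \<in> self_avoiding G" for h
    using that by (simp add: lincombs_def)
  case (Suc k)
  have "conv_power f (Suc k) x
      = conv (\<lambda>y. id (f y) - conv_unit (f y)) (\<lambda>y. conv_power id k (f y)) x"
    unfolding conv_power_Suc
  proof (rule conv_cong)
    fix h d assume h: "h \<in> Poly_Mapping.keys x" and d: "d \<in> disjoint_divisors h"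
    from h Suc.prems have "h \<in> self_avoiding G" by (auto simp: lincombs_def)
    note D = disjoint_divisors_self_avoiding[OF this d, THEN sa]
    show "f (basis d) - conv_unit (basis d) = id (f (basis d)) - conv_unit (f (basis d))"
      using unit[OF D(1)] by simp
    show "conv_power f k (basis (tquot h d)) = conv_power id k (f (basis (tquot h d)))"
      by (rule Suc.IH[OF D(2)])
  qed
  also have "\<dots> = conv_power id (Suc k) (f x)"
    unfolding conv_power_Suc
    by (rule conv_coalgebra_map[OF f Suc.prems, symmetric])
      (intro linear_diff linear_id linear_conv_unit linear_conv_power)+
  finally show ?case .
qed

lemma conv_log_coalgebra_map:
  assumes "coalgebra_map G f" "x \<in> lincombs (self_avoiding G)"
  shows "conv_log f x = conv_log id (f x)"
  unfolding conv_log_eq conv_power_coalgebra_map[OF assms] ..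

text \<open>One factor \<open>id - u\<close> splits off a nonempty subfamily \<open>D\<close>, and multiplying the two parts again returns
the whole hike. What remains is the recursion \<open>surjection_count_Suc\<close>.\<close>

lemma conv_power_id:
  fixes C :: "'v scycle set"
  assumes "finite C" "pairwise indep C"
  shows "conv_power id k (basis (trace_prod C))
    = Poly_Mapping.single (trace_prod C) (surjection_count (card C) k :: 'k::field_char_0)"
  using assms
proof (induction k arbitrary: C)
  case 0
  then show ?case
    by (simp add: conv_power_def conv_unit_basis trace_prod_eq_0_iff surjection_count_0)
next
  case (Suc k)
  let ?s = "\<lambda>D. Poly_Mapping.single (trace_prod C) (surjection_count (card (C - D)) k :: 'k)"
  have "conv_power id (Suc k) (basis (trace_prod C))
    = (\<Sum>D\<in>Pow C. star (basis (trace_prod D) - conv_unit (basis (trace_prod D)))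
        (conv_power id k (basis (trace_prod (C - D)) :: _ \<Rightarrow>\<^sub>0 'k)))"
    unfolding conv_power_Suc conv_def lin_ext_basis id_apply
    by (rule sum_disjoint_divisors[OF Suc.prems])
  also have "\<dots> = (\<Sum>D\<in>Pow C. if D = {} then 0 else ?s D)"
  proof (rule sum.cong[OF refl])
    fix D assume "D \<in> Pow C"
    then have D: "D \<subseteq> C" by simp
    have fin: "finite D" "finite (C - D)" using Suc.prems D finite_subset by auto
    have ind: "pairwise indep D" "pairwise indep (C - D)"
      using Suc.prems(2) D by (auto intro: pairwise_subset)
    have un: "D \<union> (C - D) = C" using D by blast
    have disj: "hike_verts (trace_prod D) \<inter> hike_verts (trace_prod (C - D)) = {}"
      using pairwise_indep_Un_cycles[OF fin] Suc.prems(2) unfolding un by blast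
    have split: "trace_prod D + trace_prod (C - D) = trace_prod C"
      using trace_prod_split[OF Suc.prems D] ..
    note IH = Suc.IH[OF fin(2) ind(2)]
    show "star (basis (trace_prod D) - conv_unit (basis (trace_prod D)))
        (conv_power id k (basis (trace_prod (C - D)) :: _ \<Rightarrow>\<^sub>0 'k)) = (if D = {} then 0 else ?s D)"
    proof (cases "D = {}")
      case True
      then show ?thesis
        by (simp only: trace_prod_empty conv_unit_basis simp_thms if_True diff_self
            linear_zero[OF linear_star_left])
    next
      case False
      then have "conv_unit (basis (trace_prod D)) = (0 :: 'v hike \<Rightarrow>\<^sub>0 'k)"
        using fin by (simp add: conv_unit_basis trace_prod_eq_0_iff)
      then show ?thesis
        using False disj split
        unfolding IH by (simp add: star_single)
    qed
  qed
  also have "\<dots> = (\<Sum>D\<in>Pow C - {{}}. ?s D)"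
    by (rule sum.mono_neutral_cong_right) (use Suc.prems in auto)
  also have "\<dots> = Poly_Mapping.single (trace_prod C) (surjection_count (card C) (Suc k))"
    unfolding surjection_count_Suc[OF Suc.prems(1)]
    by (rule poly_mapping_eqI) (simp add: lookup_sum lookup_single when_def)
  finally show ?case .
qed

text \<open>For \<open>a = 1\<close> the sum of all self-avoiding hikes, for \<open>a = -1\<close> the sum with signs that appears in the
determinant.\<close>

definition weighted_hike_sum :: "'v pair_pre_digraph \<Rightarrow> 'k \<Rightarrow> 'v hike \<Rightarrow>\<^sub>0 'k::field" where
  "weighted_hike_sum G a = (\<Sum>C\<in>disjoint_families G. Poly_Mapping.single (trace_prod C) (a ^ card C))"

context
  fixes G :: "'v pair_pre_digraph"
  assumes fin: "finite (simple_cycles G)"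
begin

lemma finite_disjoint_families: "finite (disjoint_families G)"
  by (rule finite_subset[of _ "Pow (simple_cycles G)"]) (use fin in \<open>auto simp: disjoint_families_def\<close>)

lemma card_disjoint_family: "C \<in> disjoint_families G \<Longrightarrow> card C \<le> card (simple_cycles G)"
  by (intro card_mono fin disjoint_familiesD)

lemma sum_cycles_eq_prime_sum:
  "(\<Sum>C\<in>disjoint_families G. Poly_Mapping.single (trace_prod C) (if card C = 1 then c else 0))
    = scale (c::'k::field) (prime_sum G)"
proof -
  have "(\<Sum>p\<in>primes G. basis p :: _ \<Rightarrow>\<^sub>0 'k)
      = (\<Sum>h\<in>self_avoiding G. if h \<in> primes G then basis h else 0)"
    by (rule sum.mono_neutral_cong_left)
      (use primes_subset_self_avoiding[of G] finite_disjoint_families in \<open>auto simp: self_avoiding_eq\<close>)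
  also have "\<dots> = (\<Sum>C\<in>disjoint_families G. Poly_Mapping.single (trace_prod C) (if card C = 1 then 1 else 0))"
    by (rule sum_image_families) (simp add: trace_prod_in_primes)
  finally show ?thesis
    by (simp add: prime_sum_def linear_sum[OF linear_scale] scale_single if_distrib cong: if_cong)
qed

text \<open>No family has more than \<open>m\<close> cycles, where \<open>m\<close> is the number of simple cycles of \<open>G\<close>; this bound
turns the series into the same finite sum for all arguments, so that it can be compared with the
projection one basis element at a time.\<close>

lemma conv_log_id:
  assumes x: "x \<in> lincombs (self_avoiding G)"
  shows "conv_log id x = lin_ext (\<lambda>h. if h \<in> primes G then basis h else 0) (x :: 'v hike \<Rightarrow>\<^sub>0 'k::field_char_0)"
proof -
  let ?m = "card (simple_cycles G)"
  let ?c = "\<lambda>k. (- 1) ^ k / of_nat (Suc k) :: 'k"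
  define F :: "nat \<Rightarrow> ('v hike \<Rightarrow>\<^sub>0 'k) \<Rightarrow> 'v hike \<Rightarrow>\<^sub>0 'k"
    where "F = (\<lambda>k x. scale (?c k) (conv_power id (Suc k) x))"
  have linear_F: "linear_on_set UNIV (F k)" for k
    unfolding F_def by (rule linear_compose[OF linear_scale linear_conv_power])
  have F_basis: "F k (basis (trace_prod C))
      = Poly_Mapping.single (trace_prod C) (?c k * surjection_count (card C) (Suc k))"
    if "C \<in> disjoint_families G" for k C
    unfolding F_def conv_power_id[OF disjoint_familiesD(2,3)[OF that]] scale_single ..
  have F_0: "F k x = 0" if "?m \<le> k" for k
  proof -
    have "F k x = (\<lambda>_. 0) x"
    proof (rule linear_eqI[OF linear_F])
      show "linear_on_set UNIV (\<lambda>_::'v hike \<Rightarrow>\<^sub>0 'k. 0 :: 'v hike \<Rightarrow>\<^sub>0 'k)" by (rule linearI) simp_all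
      fix h assume "h \<in> Poly_Mapping.keys x"
      then obtain C where C: "C \<in> disjoint_families G" "h = trace_prod C"
        using x by (auto simp: lincombs_def self_avoiding_eq)
      then have "card C < Suc k" using card_disjoint_family[OF C(1)] that by simp
      then show "F k (basis h) = 0" using C F_basis by (simp add: surjection_count_eq_0)
    qed
    then show ?thesis .
  qed
  have "conv_log id x = Sum_any (\<lambda>k. F k x)" unfolding conv_log_eq F_def ..
  also have "\<dots> = (\<Sum>k<?m. F k x)"
    by (rule Sum_any.expand_superset) (use F_0 in \<open>auto simp: not_less[symmetric]\<close>)
  also have "\<dots> = lin_ext (\<lambda>h. if h \<in> primes G then basis h else 0) x"
  proof (rule linear_eqI[OF _ linear_lin_ext, where F = "\<lambda>x. \<Sum>k<?m. F k x"])
    show "linear_on_set UNIV (\<lambda>x. \<Sum>k<?m. F k x)"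
      by (rule linear_sum_maps) (rule linear_F)
    fix h assume "h \<in> Poly_Mapping.keys x"
    then obtain C where C: "C \<in> disjoint_families G" "h = trace_prod C"
      using x by (auto simp: lincombs_def self_avoiding_eq)
    have "(\<Sum>k<?m. F k (basis h))
        = Poly_Mapping.single h (\<Sum>k<?m. ?c k * surjection_count (card C) (Suc k))"
      using C F_basis by (intro poly_mapping_eqI) (simp add: lookup_sum lookup_single when_def del: of_nat_Suc)
    also have "(\<Sum>k<?m. ?c k * surjection_count (card C) (Suc k)) = (if card C = 1 then 1 else 0)"
      by (rule log_surjection_count[OF card_disjoint_family[OF C(1)]])
    finally show "(\<Sum>k<?m. F k (basis h)) = lin_ext (\<lambda>h. if h \<in> primes G then basis h else 0) (basis h)"
      using C trace_prod_in_primes[OF C(1)] by simp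
  qed
  finally show ?thesis .
qed

lemma conv_log_id_in_primes:
  assumes "x \<in> lincombs (self_avoiding G)"
  shows "conv_log id x \<in> lincombs (primes G)"
proof -
  have "Poly_Mapping.lookup (conv_log id x) h = 0" if "h \<notin> primes G" for h
    unfolding conv_log_id[OF assms] lin_ext_def
    using that by (auto simp: lookup_sum lookup_single when_def intro!: sum.neutral)
  then show ?thesis unfolding lincombs_def by (auto simp: in_keys_iff)
qed

lemma conv_log_id_primes:
  assumes "x \<in> lincombs (primes G)"
  shows "conv_log id x = x"
proof -
  have x: "x \<in> lincombs (self_avoiding G)"
    using assms primes_subset_self_avoiding by (auto simp: lincombs_def)
  have "lin_ext (\<lambda>h. if h \<in> primes G then basis h else 0) x = id x"
    by (rule linear_eqI[OF linear_lin_ext linear_id]) (use assms in \<open>auto simp: lincombs_def\<close>)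
  then show ?thesis unfolding conv_log_id[OF x] by simp
qed

lemma lincombs_closed:
  assumes "x \<in> lincombs B"
  shows "y \<in> lincombs B \<Longrightarrow> x + y \<in> lincombs B" "scale c x \<in> lincombs B"
proof -
  show "x + y \<in> lincombs B" if "y \<in> lincombs B"
    using assms that Poly_Mapping.keys_add[of x y] unfolding lincombs_def by blast
  show "scale c x \<in> lincombs B"
    using assms by (auto simp: lincombs_def in_keys_iff)
qed

lemma projector_onto_primes:
  "projector_onto (lincombs (self_avoiding G)) (lincombs (primes G))
     (conv_log (id :: ('v hike \<Rightarrow>\<^sub>0 'k::field_char_0) \<Rightarrow> 'v hike \<Rightarrow>\<^sub>0 'k))"
  unfolding projector_onto_def
proof (intro conjI)
  show "linear_on_set (lincombs (self_avoiding G)) (conv_log (id :: ('v hike \<Rightarrow>\<^sub>0 'k) \<Rightarrow> _))"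
    unfolding linear_on_set_def
    by (auto simp: conv_log_id lincombs_closed linearD[OF linear_lin_ext])
  have "lincombs (primes G) \<subseteq> (lincombs (self_avoiding G) :: ('v hike \<Rightarrow>\<^sub>0 'k) set)"
    using primes_subset_self_avoiding by (auto simp: lincombs_def)
  then show "conv_log id ` lincombs (self_avoiding G) = (lincombs (primes G) :: ('v hike \<Rightarrow>\<^sub>0 'k) set)"
    using conv_log_id_in_primes conv_log_id_primes by (intro equalityI subsetI image_eqI[OF sym]) auto
  show "\<forall>x\<in>lincombs (self_avoiding G). conv_log id (conv_log id x) = conv_log id (x :: 'v hike \<Rightarrow>\<^sub>0 'k)"
    using conv_log_id_in_primes conv_log_id_primes by blast
qed

section \<open>The logarithm of the sum of all self-avoiding hikes\<close>

text \<open>Each nonzero product of a term \<open>A\<close> of the first factor and a term \<open>B\<close> of the remaining power is the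
hike of \<open>C = A \<union> B\<close>, with weight \<open>a\<^bsup>|A|\<^esup> a\<^bsup>|B|\<^esup> = a\<^bsup>|C|\<^esup>\<close>. Collecting the terms by \<open>C\<close> leaves a sum
over the nonempty subsets \<open>A\<close> of \<open>C\<close>, to which \<open>surjection_count_Suc\<close> applies.\<close>

lemma star_power_weighted_hike_sum:
  fixes a :: "'k::field_char_0"
  shows "(star (weighted_hike_sum G a - basis 0) ^^ k) (basis 0)
    = (\<Sum>C\<in>disjoint_families G. Poly_Mapping.single (trace_prod C) (a ^ card C * surjection_count (card C) k))"
proof (induction k)
  case 0
  have "(\<Sum>C\<in>disjoint_families G. Poly_Mapping.single (trace_prod C) (a ^ card C * surjection_count (card C) 0))
      = (\<Sum>C\<in>{{}}. Poly_Mapping.single (trace_prod C) (a ^ card C * surjection_count (card C) 0))"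
  proof (rule sum.mono_neutral_right[OF finite_disjoint_families])
    show "{{}} \<subseteq> disjoint_families G" by (simp add: disjoint_families_def)
    show "\<forall>C\<in>disjoint_families G - {{}}.
        Poly_Mapping.single (trace_prod C) (a ^ card C * surjection_count (card C) 0) = 0"
      by (auto simp: surjection_count_0 dest: disjoint_familiesD(2))
  qed
  then show ?case by (simp add: surjection_count_0)
next
  case (Suc k)
  let ?D = "disjoint_families G"
  let ?s = "\<lambda>C c. Poly_Mapping.single (trace_prod C) (c::'k)"
  let ?N = "\<lambda>C. surjection_count (card C) k :: 'k"
  have empty: "{} \<in> ?D" by (simp add: disjoint_families_def)
  have minus_one: "weighted_hike_sum G a - basis 0 = (\<Sum>C\<in>?D - {{}}. ?s C (a ^ card C))"
    using sum.remove[OF finite_disjoint_families empty, of "\<lambda>C. ?s C (a ^ card C)"]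
    by (simp add: weighted_hike_sum_def)
  have "(star (weighted_hike_sum G a - basis 0) ^^ Suc k) (basis 0)
    = star (\<Sum>C\<in>?D - {{}}. ?s C (a ^ card C)) (\<Sum>C\<in>?D. ?s C (a ^ card C * ?N C))"
    unfolding funpow.simps comp_apply Suc.IH unfolding minus_one ..
  also have "\<dots> = (\<Sum>A\<in>?D - {{}}. \<Sum>B\<in>?D. star (?s A (a ^ card A)) (?s B (a ^ card B * ?N B)))"
    unfolding linear_sum[OF linear_star_left] linear_sum[OF linear_star_right] by (rule sum.swap)
  also have "\<dots> = (\<Sum>(A, B)\<in>(?D - {{}}) \<times> ?D. star (?s A (a ^ card A)) (?s B (a ^ card B * ?N B)))"
    by (simp add: sum.cartesian_product)
  also have "\<dots> = (\<Sum>(C, A)\<in>Sigma ?D (\<lambda>C. Pow C - {{}}). ?s C (a ^ card C * ?N (C - A)))"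
  proof (rule sum.mono_neutral_cong_right[THEN trans])
    \<comment> \<open>Pairs of families that meet contribute \<open>0\<close>; the others correspond to a family with a nonempty
      subfamily.\<close>
    let ?P = "{(A, B) \<in> (?D - {{}}) \<times> ?D. hike_verts (trace_prod A) \<inter> hike_verts (trace_prod B) = {}}"
    let ?t = "\<lambda>(A, B). ?s (A \<union> B) (a ^ card (A \<union> B) * ?N B)"
    show "finite ((?D - {{}}) \<times> ?D)" using finite_disjoint_families by simp
    show "?P \<subseteq> (?D - {{}}) \<times> ?D" by blast
    show "\<forall>p\<in>(?D - {{}}) \<times> ?D - ?P. (case p of (A, B) \<Rightarrow> star (?s A (a ^ card A)) (?s B (a ^ card B * ?N B))) = 0"
      by (auto simp only: star_single split: if_splits)
    have un: "A \<union> B \<in> ?D \<and> A \<inter> B = {} \<and> trace_prod A + trace_prod B = trace_prod (A \<union> B)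
        \<and> card (A \<union> B) = card A + card B"
      if "(A, B) \<in> ?P" for A B
    proof -
      have A: "A \<in> ?D" and B: "B \<in> ?D" using that by auto
      have *: "pairwise indep (A \<union> B) \<and> A \<inter> B = {}"
        using pairwise_indep_Un_cycles[OF disjoint_familiesD(2)[OF A] disjoint_familiesD(2)[OF B]]
          disjoint_familiesD(3)[OF A] disjoint_familiesD(3)[OF B] that by blast
      then show ?thesis
        using disjoint_familiesD[OF A] disjoint_familiesD[OF B] trace_prod_Un[of A B]
        by (simp add: disjoint_families_def card_Un_disjoint)
    qed
    show "(case p of (A, B) \<Rightarrow> star (?s A (a ^ card A)) (?s B (a ^ card B * ?N B))) = ?t p" if "p \<in> ?P" for p
      using that un[of "fst p" "snd p"] by (auto simp: star_single power_add mult.assoc)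
    show "sum ?t ?P = (\<Sum>(C, A)\<in>Sigma ?D (\<lambda>C. Pow C - {{}}). ?s C (a ^ card C * ?N (C - A)))"
    proof (rule sum.reindex_bij_witness[where i = "\<lambda>(C, A). (A, C - A)" and j = "\<lambda>(A, B). (A \<union> B, A)"])
      fix p assume "p \<in> Sigma ?D (\<lambda>C. Pow C - {{}})"
      then obtain C A where p: "p = (C, A)" "C \<in> ?D" "A \<subseteq> C" "A \<noteq> {}" by blast
      have eq: "A \<union> (C - A) = C" using p by blast
      have sub: "A \<in> ?D" "C - A \<in> ?D" using disjoint_families_subset[OF p(2)] p(3) by blast+
      have "hike_verts (trace_prod A) \<inter> hike_verts (trace_prod (C - A)) = {}"
        using pairwise_indep_Un_cycles[of A "C - A"] disjoint_familiesD[OF sub(1)] disjoint_familiesD[OF sub(2)]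
          disjoint_familiesD(3)[OF p(2)] unfolding eq by blast
      then show "(case p of (C, A) \<Rightarrow> (A, C - A)) \<in> ?P" using p sub by auto
      show "(case (case p of (C, A) \<Rightarrow> (A, C - A)) of (A, B) \<Rightarrow> (A \<union> B, A)) = p" using p eq by simp
    next
      fix p assume p: "p \<in> ?P"
      obtain A B where AB: "p = (A, B)" by (cases p)
      from p un[of A B] have u: "A \<union> B \<in> ?D" "A \<inter> B = {}" "A \<noteq> {}" unfolding AB by auto
      then have d: "A \<union> B - A = B" by blast
      show "(case (case p of (A, B) \<Rightarrow> (A \<union> B, A)) of (C, A) \<Rightarrow> (A, C - A)) = p" using AB d by simp
      show "(case p of (A, B) \<Rightarrow> (A \<union> B, A)) \<in> Sigma ?D (\<lambda>C. Pow C - {{}})" using AB u by simp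
      show "(case (case p of (A, B) \<Rightarrow> (A \<union> B, A)) of (C, A) \<Rightarrow> ?s C (a ^ card C * ?N (C - A))) = ?t p"
        using AB d by simp
    qed
  qed
  also have "\<dots> = (\<Sum>C\<in>?D. \<Sum>A\<in>Pow C - {{}}. ?s C (a ^ card C * ?N (C - A)))"
    by (rule sum.Sigma[symmetric]) (auto simp: finite_disjoint_families dest: disjoint_familiesD)
  also have "\<dots> = (\<Sum>C\<in>?D. ?s C (a ^ card C * surjection_count (card C) (Suc k)))"
  proof (rule sum.cong[OF refl])
    fix C assume C: "C \<in> ?D"
    show "(\<Sum>A\<in>Pow C - {{}}. ?s C (a ^ card C * ?N (C - A))) = ?s C (a ^ card C * surjection_count (card C) (Suc k))"
      unfolding surjection_count_Suc[OF disjoint_familiesD(2)[OF C]]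
      by (intro poly_mapping_eqI) (simp add: lookup_sum lookup_single when_def sum_distrib_left)
  qed
  finally show ?case .
qed

lemma star_log_weighted_hike_sum:
  "star_log (weighted_hike_sum G a) = scale (a :: 'k::field_char_0) (prime_sum G)"
proof -
  let ?D = "disjoint_families G" and ?m = "card (simple_cycles G)"
  let ?s = "\<lambda>C c. Poly_Mapping.single (trace_prod C) (c::'k)"
  let ?c = "\<lambda>k. (- 1) ^ k / of_nat (Suc k) :: 'k"
  let ?F = "\<lambda>k. \<Sum>C\<in>?D. ?s C (a ^ card C * (?c k * surjection_count (card C) (Suc k)))"
  have "star_log (weighted_hike_sum G a) = Sum_any ?F"
    unfolding star_log_def star_power_weighted_hike_sum
    by (simp add: linear_sum[OF linear_scale] scale_single mult.left_commute del: of_nat_Suc)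
  also have "\<dots> = (\<Sum>k<?m. ?F k)"
  proof (rule Sum_any.expand_superset)
    have "?F k = 0" if "?m \<le> k" for k
    proof (rule sum.neutral, rule ballI)
      fix C assume "C \<in> ?D"
      then have "card C < Suc k" using card_disjoint_family[of C] that by simp
      then show "?s C (a ^ card C * (?c k * surjection_count (card C) (Suc k))) = 0"
        by (simp add: surjection_count_eq_0)
    qed
    then show "{k. ?F k \<noteq> 0} \<subseteq> {..<?m}" by (auto simp: not_less[symmetric])
  qed simp
  also have "\<dots> = (\<Sum>C\<in>?D. \<Sum>k<?m. ?s C (a ^ card C * (?c k * surjection_count (card C) (Suc k))))"
    by (rule sum.swap)
  also have "\<dots> = (\<Sum>C\<in>?D. ?s C (a ^ card C * (\<Sum>k<?m. ?c k * surjection_count (card C) (Suc k))))"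
    by (intro sum.cong refl poly_mapping_eqI)
      (simp add: lookup_sum lookup_single when_def sum_distrib_left del: of_nat_Suc)
  also have "\<dots> = (\<Sum>C\<in>?D. ?s C (if card C = 1 then a else 0))"
  proof (rule sum.cong[OF refl])
    fix C assume "C \<in> ?D"
    note log = log_surjection_count[OF card_disjoint_family[OF this]]
    show "?s C (a ^ card C * (\<Sum>k<?m. ?c k * surjection_count (card C) (Suc k))) = ?s C (if card C = 1 then a else 0)"
      unfolding log by simp
  qed
  also have "\<dots> = scale a (prime_sum G)" by (rule sum_cycles_eq_prime_sum)
  finally show ?thesis .
qed

end

section \<open>Simple cycles as cyclic vertex lists\<close>

text \<open>A walk read as the list of its tails and the list of its heads: consecutive arcs fit together when
the one list is the other shifted by one place. For closed walks the shift is a rotation.\<close>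

lemma pcas_iff: "pcas u p v \<longleftrightarrow> map fst p @ [v] = u # map snd p"
  by (induction p arbitrary: u) auto

lemma pawalk_verts_eq: "pcas u p v \<Longrightarrow> pawalk_verts u p = map fst p @ [v]"
  by (induction p arbitrary: u) auto

lemma cycle_iff_zip_rotate:
  assumes "pair_wf_digraph G"
  shows "pre_digraph.cycle (with_proj G) p
    \<longleftrightarrow> (\<exists>vs. distinct vs \<and> vs \<noteq> [] \<and> p = zip vs (rotate1 vs) \<and> set p \<subseteq> parcs G)"
proof
  assume cyc: "pre_digraph.cycle (with_proj G) p"
  then obtain u where p: "pcas u p u" "p \<noteq> []" "set p \<subseteq> parcs G"
    by (auto simp: pre_digraph.cycle_def pre_digraph.awalk_def cas_with_proj_eq)
  then obtain e q where "p = e # q" by (cases p) auto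
  with p(1) have "map snd p = rotate1 (map fst p)" by (simp add: pcas_iff)
  then have "p = zip (map fst p) (rotate1 (map fst p))" by (metis zip_map_fst_snd)
  then show "\<exists>vs. distinct vs \<and> vs \<noteq> [] \<and> p = zip vs (rotate1 vs) \<and> set p \<subseteq> parcs G"
    using cycle_distinct_tails[OF cyc] p by (intro exI[of _ "map fst p"]) simp
next
  assume "\<exists>vs. distinct vs \<and> vs \<noteq> [] \<and> p = zip vs (rotate1 vs) \<and> set p \<subseteq> parcs G"
  then obtain u us where us: "distinct (u # us)" "p = zip (u # us) (us @ [u])" "set p \<subseteq> parcs G"
    by (metis neq_Nil_conv rotate1.simps(2))
  have fs: "map fst p = u # us" "map snd p = us @ [u]" unfolding us(2) by simp_all
  have cas: "pcas u p u" by (simp add: pcas_iff fs)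
  have "p \<noteq> []" using fs by auto
  moreover from this us(3) have "fst (hd p) \<in> pverts G"
    using pair_wf_digraph.arc_fst_in_verts[OF assms] hd_in_set[of p] by blast
  then have "u \<in> pverts G" using fs(1) \<open>p \<noteq> []\<close> by (cases p) auto
  moreover have "distinct (tl (pawalk_verts u p))"
    unfolding pawalk_verts_eq[OF cas] fs using us(1) by simp
  ultimately show "pre_digraph.cycle (with_proj G) p"
    using cas us(3)
    by (auto simp: pre_digraph.cycle_def pre_digraph.awalk_def cas_with_proj_eq awalk_verts_with_proj_eq)
qed

lemma pair_wf_complete_digraph: "pair_wf_digraph complete_digraph"
  by unfold_locales simp_all

text \<open>A cycle given by its vertices in order of passage, the form in which cycles enter the theory of
permutations.\<close>

definition cycle_through :: "'v list \<Rightarrow> 'v scycle" where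
  "cycle_through vs = abs_scycle (zip vs (rotate1 vs))"

lift_definition cycle_arcs :: "'v scycle \<Rightarrow> ('v \<times> 'v) set" is set
  by (auto simp: same_cycle_def)

lemma same_cycle_zip_rotate:
  assumes "distinct vs" "vs \<noteq> []"
  shows "same_cycle (zip vs (rotate1 vs)) (zip vs (rotate1 vs))"
  using assms cycle_iff_zip_rotate[OF pair_wf_complete_digraph] unfolding same_cycle_def
  by (auto intro: exI[of _ 0])

lemma scycle_cases_list:
  obtains vs where "c = cycle_through vs" "distinct vs" "vs \<noteq> []"
proof -
  obtain p where p: "c = abs_scycle p" "same_cycle p p" by (rule scycle_cases)
  then obtain vs where "distinct vs" "vs \<noteq> []" "p = zip vs (rotate1 vs)"
    using cycle_iff_zip_rotate[OF pair_wf_complete_digraph] unfolding same_cycle_def by blast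
  with p that show ?thesis unfolding cycle_through_def by blast
qed

lemma zip_rotate1_eq_map:
  assumes "distinct vs"
  shows "zip vs (rotate1 vs) = map (\<lambda>i. (i, cycle_of_list vs i)) vs"
proof -
  have "zip vs (map f vs) = map (\<lambda>i. (i, f i)) vs" for f :: "'a \<Rightarrow> 'a"
    by (induction vs) auto
  moreover have "map (cycle_of_list vs) vs = rotate1 vs"
    using cyclic_rotation[OF assms, of 1] by simp
  ultimately show ?thesis by metis
qed

lemma cycle_arcs_through:
  assumes "distinct vs" "vs \<noteq> []"
  shows "cycle_arcs (cycle_through vs) = (\<lambda>i. (i, cycle_of_list vs i)) ` set vs"
  using same_cycle_zip_rotate[OF assms] zip_rotate1_eq_map[OF assms(1)]
  unfolding cycle_through_def by (simp add: cycle_arcs.abs_eq)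

lemma cycle_verts_through:
  assumes "distinct vs" "vs \<noteq> []"
  shows "cycle_verts (cycle_through vs) = set vs"
  unfolding cycle_through_def cycle_verts.abs_eq[OF same_cycle_zip_rotate[OF assms]]
  by (simp flip: set_map)

lemma cycle_through_rotate:
  assumes "distinct vs" "vs \<noteq> []"
  shows "cycle_through (rotate n vs) = cycle_through vs"
proof -
  have "zip (rotate n vs) (rotate1 (rotate n vs)) = rotate n (zip vs (rotate1 vs))"
    using assms by (simp add: zip_rotate1_eq_map rotate_map flip: cycle_of_list_rotate_independent)
  moreover have "same_cycle (zip vs (rotate1 vs)) (rotate n (zip vs (rotate1 vs)))"
    using same_cycle_zip_rotate[OF assms] same_cycle_zip_rotate[of "rotate n vs"] assms calculation
    unfolding same_cycle_def by auto
  ultimately show ?thesis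
    unfolding cycle_through_def using Quotient_rel_abs[OF Quotient_scycle] by metis
qed

text \<open>The starting vertex of a cycle is immaterial, so any of its vertices may be taken.\<close>

lemma in_cycle_verts_obtains:
  assumes "v \<in> cycle_verts c"
  obtains vs where "c = cycle_through (v # vs)" "distinct (v # vs)"
proof -
  obtain us where us: "c = cycle_through us" "distinct us" "us \<noteq> []" by (rule scycle_cases_list)
  then obtain xs ys where xy: "us = xs @ v # ys"
    using assms cycle_verts_through by (metis split_list)
  then have "rotate (length xs) us = v # ys @ xs" by (simp add: rotate_append)
  with us that show ?thesis using cycle_through_rotate[of us "length xs"] distinct_rotate by metis
qed

lemma simple_cycles_iff:
  assumes "pair_wf_digraph G"
  shows "c \<in> simple_cycles G \<longleftrightarrow> cycle_arcs c \<subseteq> parcs G"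
proof
  assume "c \<in> simple_cycles G"
  then obtain p where c: "c = abs_scycle p" and p: "pre_digraph.cycle (with_proj G) p"
    unfolding simple_cycles_def by blast
  from p obtain vs where vs: "distinct vs" "vs \<noteq> []" "p = zip vs (rotate1 vs)" "set p \<subseteq> parcs G"
    unfolding cycle_iff_zip_rotate[OF assms] by blast
  then show "cycle_arcs c \<subseteq> parcs G"
    using same_cycle_zip_rotate[OF vs(1,2)] by (simp add: c cycle_arcs.abs_eq)
next
  assume arcs: "cycle_arcs c \<subseteq> parcs G"
  obtain vs where vs: "c = cycle_through vs" "distinct vs" "vs \<noteq> []" by (rule scycle_cases_list)
  then have "set (zip vs (rotate1 vs)) \<subseteq> parcs G"
    using arcs same_cycle_zip_rotate[OF vs(2,3)] by (simp add: cycle_through_def cycle_arcs.abs_eq)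
  then have "pre_digraph.cycle (with_proj G) (zip vs (rotate1 vs))"
    using vs cycle_iff_zip_rotate[OF assms] by blast
  then show "c \<in> simple_cycles G" unfolding simple_cycles_def vs(1) cycle_through_def by blast
qed

lemma finite_simple_cycles:
  assumes "pair_fin_digraph G"
  shows "finite (simple_cycles G)"
proof -
  interpret pair_fin_digraph G by fact
  have "{p. pre_digraph.cycle (with_proj G) p} \<subseteq> {p. set p \<subseteq> parcs G \<and> length p \<le> card (parcs G)}"
  proof safe
    fix p assume cyc: "pre_digraph.cycle (with_proj G) p"
    then show sub: "e \<in> parcs G" if "e \<in> set p" for e
      using that by (auto simp: pre_digraph.cycle_def pre_digraph.awalk_def)
    have "distinct p" using cycle_distinct_tails[OF cyc] by (simp add: distinct_map)
    then show "length p \<le> card (parcs G)"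
      using sub card_mono[OF pair_finite_arcs] by (metis distinct_card subsetI)
  qed
  then have "finite {p. pre_digraph.cycle (with_proj G) p}"
    by (rule finite_subset) (rule finite_lists_length_le[OF pair_finite_arcs])
  then show ?thesis unfolding simple_cycles_def by simp
qed

section \<open>Disjoint cycles and permutations\<close>

text \<open>The hypothesis says that \<open>\<sigma>\<close> maps each entry of the list to the next one and the last to the first.
So the entries are \<open>v, \<sigma> v, \<sigma>\<^sup>2 v, \<dots>\<close>, and distinctness makes the length the first positive
exponent at which \<open>v\<close> recurs.\<close>

lemma orbit_list_unique:
  assumes "distinct (v # vs)" "map \<sigma> (v # vs) = vs @ [v]"
  shows "v # vs = support \<sigma> v"
proof -
  have step: "(vs @ [v]) ! i = \<sigma> ((v # vs) ! i)" if "i \<le> length vs" for i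
    using arg_cong[OF assms(2), of "\<lambda>xs. xs ! i"] that by (simp del: list.map)
  have nth: "(v # vs) ! i = (\<sigma> ^^ i) v" if "i \<le> length vs" for i
    using that
  proof (induction i)
    case (Suc i)
    then have "(v # vs) ! Suc i = (vs @ [v]) ! i" by (simp add: nth_append)
    with Suc step[of i] show ?case by simp
  qed simp
  have "(\<sigma> ^^ Suc (length vs)) v = v"
    using step[of "length vs"] nth[of "length vs"] by simp
  then have le: "least_power \<sigma> v \<le> Suc (length vs)" and eq: "(\<sigma> ^^ least_power \<sigma> v) v = v"
    and pos: "least_power \<sigma> v > 0"
    using least_power_le least_powerI by (metis zero_less_Suc)+
  have "least_power \<sigma> v = Suc (length vs)"
  proof (rule ccontr)
    assume "least_power \<sigma> v \<noteq> Suc (length vs)"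
    with le have l: "least_power \<sigma> v \<le> length vs" by simp
    have "(v # vs) ! least_power \<sigma> v = (v # vs) ! 0" using nth[OF l] eq by simp
    with assms(1) l pos show False by (metis length_Cons less_Suc_eq_le nth_eq_iff_index_eq zero_less_Suc less_numeral_extra(3))
  qed
  then show ?thesis
    by (intro nth_equalityI) (use nth in \<open>auto simp del: upt_Suc nth_Cons_Suc simp: less_Suc_eq_le\<close>)
qed

text \<open>When every vertex has at most one successor, a cycle is traced out by following successors from any
of its vertices, so two cycles with a common vertex coincide.\<close>

lemma cycle_eqI:
  assumes c: "cycle_arcs c \<subseteq> range (\<lambda>i. (i, \<sigma> i))" and c': "cycle_arcs c' \<subseteq> range (\<lambda>i. (i, \<sigma> i))"
    and v: "v \<in> cycle_verts c" "v \<in> cycle_verts c'"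
  shows "c = c'"
proof -
  have *: "c = cycle_through (support \<sigma> v)"
    if arcs: "cycle_arcs c \<subseteq> range (\<lambda>i. (i, \<sigma> i))" and v: "v \<in> cycle_verts c" for c
  proof -
    obtain vs where vs: "c = cycle_through (v # vs)" "distinct (v # vs)"
      using in_cycle_verts_obtains[OF v] .
    have "cycle_of_list (v # vs) i = \<sigma> i" if "i \<in> set (v # vs)" for i
      using arcs that unfolding vs(1) cycle_arcs_through[OF vs(2) list.distinct(2)] by blast
    then have "map \<sigma> (v # vs) = map (cycle_of_list (v # vs)) (v # vs)"
      by (intro map_cong) auto
    also have "\<dots> = vs @ [v]" using cyclic_rotation[OF vs(2), of 1] by simp
    finally show ?thesis using orbit_list_unique[OF vs(2)] vs(1) by metis
  qed
  show ?thesis using *[OF c v(1)] *[OF c' v(2)] by simp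
qed

definition family_verts :: "'v scycle set \<Rightarrow> 'v set" where
  "family_verts C = (\<Union>c\<in>C. cycle_verts c)"

definition family_arcs :: "'v scycle set \<Rightarrow> ('v \<times> 'v) set" where
  "family_arcs C = (\<Union>c\<in>C. cycle_arcs c)"

text \<open>The permutation moving every vertex of the family to its successor. The sign condition is equivalent
to \<open>sign \<sigma> = (-1)\<^bsup>|V| - |C|\<^esup>\<close>, each cycle of length \<open>l\<close> having sign \<open>(-1)\<^bsup>l - 1\<^esup>\<close>; it is written
without subtraction and in the form in which it enters the determinant.\<close>

definition family_perm :: "'v scycle set \<Rightarrow> ('v \<Rightarrow> 'v) \<Rightarrow> bool" where
  "family_perm C \<sigma> \<longleftrightarrow> \<sigma> permutes family_verts C
     \<and> family_arcs C = (\<lambda>i. (i, \<sigma> i)) ` family_verts C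
     \<and> sign \<sigma> * (- 1) ^ card (family_verts C) = (- 1) ^ card C"

lemma family_perm_unique:
  assumes "family_perm C \<sigma>" "family_perm C \<tau>"
  shows "\<sigma> = \<tau>"
proof
  fix i show "\<sigma> i = \<tau> i"
  proof (cases "i \<in> family_verts C")
    case True
    then have "(i, \<sigma> i) \<in> family_arcs C" using assms(1) by (simp add: family_perm_def)
    then show ?thesis using assms(2) by (auto simp: family_perm_def)
  next
    case False
    then show ?thesis using assms unfolding family_perm_def by (metis permutes_not_in)
  qed
qed

lemma sign_cycle_of_list:
  assumes "vs \<noteq> []" "distinct vs"
  shows "sign (cycle_of_list vs) * (- 1) ^ length vs = - 1"
  using assms
proof (induction vs rule: cycle_of_list.induct)
  case (1 i j cs)
  then have "sign (cycle_of_list (i # j # cs)) = - sign (cycle_of_list (j # cs))"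
    unfolding cycle_of_list.simps(1)
    by (subst sign_compose) (auto simp: sign_swap_id permutation_of_cycle permutation_swap_id)
  then have "sign (cycle_of_list (i # j # cs)) * (- 1) ^ length (i # j # cs)
      = sign (cycle_of_list (j # cs)) * (- 1) ^ length (j # cs)"
    by (simp only: list.size power_add power_one_right add_Suc_right add_0_right) simp
  also have "\<dots> = - 1" by (rule 1) (use 1 in auto)
  finally show ?case .
qed simp_all

lemma finite_cycle_verts: "finite (cycle_verts c)"
  by (metis List.finite_set scycle_cases_list cycle_verts_through)

text \<open>Adjoining a disjoint cycle multiplies the permutation by that cycle. This one step drives both
directions of the correspondence: from families to permutations by induction on the family, and
back by induction along a cycle decomposition.\<close>

lemma family_perm_insert:
  assumes C: "finite C" "pairwise indep C" "family_perm C \<sigma>"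
    and vs: "distinct vs" "vs \<noteq> []" "set vs \<inter> family_verts C = {}"
  shows "pairwise indep (insert (cycle_through vs) C)"
    and "family_verts (insert (cycle_through vs) C) = set vs \<union> family_verts C"
    and "family_perm (insert (cycle_through vs) C) (cycle_of_list vs \<circ> \<sigma>)"
proof -
  let ?c = "cycle_through vs" and ?q = "cycle_of_list vs" and ?V = "family_verts C"
  have verts: "cycle_verts ?c = set vs" by (rule cycle_verts_through[OF vs(1,2)])
  have disj: "cycle_verts ?c \<inter> cycle_verts d = {}" if "d \<in> C" for d
    using that vs(3) unfolding verts family_verts_def by blast
  show "pairwise indep (insert ?c C)"
    using C(2) disj by (auto simp: pairwise_insert indep_scycle_def Int_commute)
  show V: "family_verts (insert ?c C) = set vs \<union> ?V" by (simp add: family_verts_def verts)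
  have notin: "?c \<notin> C" using disj[of ?c] cycle_verts_nonempty[of ?c] by auto
  have \<sigma>: "\<sigma> permutes ?V" "family_arcs C = (\<lambda>i. (i, \<sigma> i)) ` ?V"
    "sign \<sigma> * (- 1) ^ card ?V = (- 1) ^ card C"
    using C(3) by (auto simp: family_perm_def)
  have finV: "finite ?V" using C(1) by (simp add: family_verts_def finite_cycle_verts)
  have "?q \<circ> \<sigma> permutes set vs \<union> ?V"
    by (rule permutes_compose[OF permutes_subset[OF \<sigma>(1)] permutes_subset[OF cycle_permutes]]) auto
  moreover have "family_arcs (insert ?c C) = (\<lambda>i. (i, (?q \<circ> \<sigma>) i)) ` (set vs \<union> ?V)"
  proof -
    have "(?q \<circ> \<sigma>) i = ?q i" if "i \<in> set vs" for i
      using that vs(3) \<sigma>(1) by (auto simp: permutes_def)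
    then have "(\<lambda>i. (i, ?q i)) ` set vs = (\<lambda>i. (i, (?q \<circ> \<sigma>) i)) ` set vs"
      by (intro image_cong) auto
    moreover have "(?q \<circ> \<sigma>) i = \<sigma> i" if "i \<in> ?V" for i
      using that vs(3) permutes_in_image[OF \<sigma>(1)] by (auto intro: id_outside_supp)
    then have "(\<lambda>i. (i, \<sigma> i)) ` ?V = (\<lambda>i. (i, (?q \<circ> \<sigma>) i)) ` ?V"
      by (intro image_cong) auto
    ultimately show ?thesis
      using \<sigma>(2) cycle_arcs_through[OF vs(1,2)] by (simp add: family_arcs_def image_Un)
  qed
  moreover have "sign (?q \<circ> \<sigma>) * (- 1) ^ card (set vs \<union> ?V) = (- 1) ^ card (insert ?c C)"
  proof -
    have "permutation \<sigma>" using \<sigma>(1) finV permutation_permutes by blast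
    then have "sign (?q \<circ> \<sigma>) * (- 1) ^ card (set vs \<union> ?V)
        = (sign ?q * (- 1) ^ length vs) * (sign \<sigma> * (- 1) ^ card ?V)"
      using vs finV by (simp add: sign_compose permutation_of_cycle card_Un_disjoint distinct_card power_add)
    then show ?thesis
      unfolding sign_cycle_of_list[OF vs(2,1)] \<sigma>(3) using notin C(1) by simp
  qed
  ultimately show "family_perm (insert ?c C) (?q \<circ> \<sigma>)"
    unfolding family_perm_def V by blast
qed

lemma family_perm_empty: "family_perm {} id"
  by (simp add: family_perm_def family_verts_def family_arcs_def permutes_id)

lemma family_perm_exists:
  assumes "finite C" "pairwise indep C"
  shows "\<exists>\<sigma>. family_perm C \<sigma>"
  using assms
proof (induction C rule: finite_induct)
  case empty
  show ?case using family_perm_empty by blast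
next
  case (insert c C)
  then obtain \<sigma> where \<sigma>: "family_perm C \<sigma>" by (auto simp: pairwise_insert)
  obtain vs where vs: "c = cycle_through vs" "distinct vs" "vs \<noteq> []" by (rule scycle_cases_list)
  have "indep c d" if "d \<in> C" for d
    using insert that by (auto simp: pairwise_insert)
  then have "cycle_verts c \<inter> family_verts C = {}"
    by (auto simp: family_verts_def indep_scycle_def)
  then have "set vs \<inter> family_verts C = {}"
    using cycle_verts_through[OF vs(2,3)] vs(1) by simp
  with family_perm_insert(3)[OF insert.hyps(1) _ \<sigma> vs(2,3)] insert.prems show ?case
    unfolding vs(1) by (auto simp: pairwise_insert)
qed

definition induced_perm :: "'v scycle set \<Rightarrow> 'v \<Rightarrow> 'v" where
  "induced_perm C = (SOME \<sigma>. family_perm C \<sigma>)"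

lemma induced_perm:
  assumes "finite C" "pairwise indep C"
  shows "family_perm C (induced_perm C)"
  unfolding induced_perm_def using family_perm_exists[OF assms] by (rule someI_ex)

text \<open>A fixed point in \<open>S\<close> becomes a loop, whose vertex list has length one. Cycle decompositions may also
contain empty lists, which give no cycle and are skipped.\<close>

lemma permutation_family_exists:
  assumes "finite S" "\<sigma> permutes S"
  shows "\<exists>C. finite C \<and> pairwise indep C \<and> family_verts C = S \<and> family_perm C \<sigma>"
  using cycle_decomposition[OF assms(2,1)]
proof (induction rule: cycle_decomp.induct)
  case empty
  show ?case
    by (intro exI[of _ "{}"] conjI family_perm_empty) (simp_all add: family_verts_def)
next
  case (comp I p cs)
  then obtain C where C: "finite C" "pairwise indep C" "family_verts C = I" "family_perm C p" by blast
  show ?case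
  proof (cases "cs = []")
    case True
    with C show ?thesis by auto
  next
    case False
    have "set cs \<inter> family_verts C = {}" using comp.hyps(3) C(3) by simp
    note ins = family_perm_insert[OF C(1,2,4) comp.hyps(2) False this]
    show ?thesis
      by (intro exI[of _ "insert (cycle_through cs) C"] conjI ins) (simp_all add: C(1) ins(2) C(3))
  qed
qed

text \<open>The edges form the graph of a permutation, so through every vertex there passes at most one cycle
with edges among them, and it must belong to both families.\<close>

lemma family_arcs_inj:
  assumes C: "finite C" "pairwise indep C" and D: "finite D" "pairwise indep D"
    and eq: "family_arcs C = family_arcs D"
  shows "C = D"
proof -
  have sub: "C \<subseteq> D" if C: "finite C" "pairwise indep C" and D: "finite D" "pairwise indep D"
    and eq: "family_arcs C = family_arcs D" for C D :: "'a scycle set"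
  proof
    fix c assume c: "c \<in> C"
    obtain \<sigma> where \<sigma>: "family_perm C \<sigma>" using family_perm_exists[OF C] by blast
    obtain \<tau> where \<tau>: "family_perm D \<tau>" using family_perm_exists[OF D] by blast
    obtain v where v: "v \<in> cycle_verts c" using cycle_verts_nonempty[of c] by blast
    have fst_arcs: "fst ` family_arcs E = family_verts E" if "family_perm E \<rho>" for E and \<rho> :: "'a \<Rightarrow> 'a"
      using that by (force simp: family_perm_def image_image)
    have "v \<in> family_verts D"
      using fst_arcs[OF \<sigma>] fst_arcs[OF \<tau>] eq c v by (auto simp: family_verts_def)
    then obtain d where d: "d \<in> D" "v \<in> cycle_verts d" by (auto simp: family_verts_def)
    have graph: "family_arcs C \<subseteq> range (\<lambda>i. (i, \<sigma> i))" using \<sigma> by (auto simp: family_perm_def)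
    have "c = d"
    proof (rule cycle_eqI[OF _ _ v d(2)])
      show "cycle_arcs c \<subseteq> range (\<lambda>i. (i, \<sigma> i))" using graph c by (auto simp: family_arcs_def)
      show "cycle_arcs d \<subseteq> range (\<lambda>i. (i, \<sigma> i))" using graph d(1) unfolding eq by (auto simp: family_arcs_def)
    qed
    with d(1) show "c \<in> D" by simp
  qed
  show ?thesis using sub[OF C D eq] sub[OF D C eq[symmetric]] by blast
qed

section \<open>Hikes as products of edges\<close>

definition edge_letter :: "'v \<times> 'v \<Rightarrow> 'v edge_var" where
  "edge_letter e = Omega (fst e) (snd e)"

lemma inj_edge_letter: "inj edge_letter"
  by (rule injI) (simp add: edge_letter_def prod_eq_iff)

text \<open>Edge variables commute when their tails differ, which distinct edges of the graph of a function
have. This is what makes the product of the edges of a family independent of the order.\<close>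

lemma pairwise_indep_edge_letters:
  assumes "E \<subseteq> range (\<lambda>i. (i, \<sigma> i))"
  shows "pairwise indep (edge_letter ` E)"
proof (rule pairwiseI)
  fix a b assume "a \<in> edge_letter ` E" "b \<in> edge_letter ` E" and neq: "a \<noteq> b"
  then obtain e e' where e: "e \<in> E" "a = edge_letter e" and e': "e' \<in> E" "b = edge_letter e'" by blast
  have "snd e = \<sigma> (fst e)" "snd e' = \<sigma> (fst e')" using assms e(1) e'(1) by auto
  with neq have "fst e \<noteq> fst e'" unfolding e(2) e'(2) edge_letter_def by auto
  then show "indep a b" by (simp add: e(2) e'(2) edge_letter_def)
qed

lemma hike_edges_plus: "hike_edges (s + t) = hike_edges s + hike_edges t"
proof -
  obtain u where u: "s = sum_list (map gen u)" by (rule trace_cases)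
  obtain v where v: "t = sum_list (map gen v)" by (rule trace_cases)
  show ?thesis
    using hike_edges_sum_list[of "u @ v"] unfolding u v by (simp add: hike_edges_sum_list)
qed

lemma hike_edges_gen: "hike_edges (gen c) = cycle_edges c"
  using hike_edges_sum_list[of "[c]"] by simp

lemma hike_edges_0: "hike_edges 0 = 0"
  using hike_edges_sum_list[of "[]"] by simp

lemma cycle_edges_eq: "cycle_edges c = trace_prod (edge_letter ` cycle_arcs c)"
proof -
  obtain vs where vs: "c = cycle_through vs" "distinct vs" "vs \<noteq> []" by (rule scycle_cases_list)
  define p where "p = zip vs (rotate1 vs)"
  have p: "c = abs_scycle p" "same_cycle p p"
    using vs same_cycle_zip_rotate by (simp_all add: p_def cycle_through_def)
  have "distinct p" using vs(2) by (simp add: p_def distinct_zipI1)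
  then have d: "distinct (map edge_letter p)"
    using inj_on_subset[OF inj_edge_letter subset_UNIV] by (simp add: distinct_map)
  have "cycle_arcs c \<subseteq> range (\<lambda>i. (i, cycle_of_list vs i))"
    using cycle_arcs_through[OF vs(2,3)] vs(1) by auto
  moreover have set_p: "set p = cycle_arcs c" using p by (simp add: cycle_arcs.abs_eq)
  ultimately have "pairwise indep (set (map edge_letter p))"
    using pairwise_indep_edge_letters by (metis list.set_map)
  from trace_prod_set[OF this d]
  have "trace_prod (edge_letter ` cycle_arcs c) = sum_list (map gen (map edge_letter p))"
    by (simp add: set_p)
  also have "map edge_letter p = map (\<lambda>(i, j). Omega i j) p"
    by (simp add: edge_letter_def case_prod_beta)
  finally show ?thesis
    unfolding p(1) cycle_edges.abs_eq[OF p(2)] abs_trace_sum_list ..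
qed

lemma family_arcs_graph:
  assumes "finite C" "pairwise indep C"
  shows "\<exists>\<sigma>. family_arcs C \<subseteq> range (\<lambda>i. (i, \<sigma> i))"
proof -
  obtain \<sigma> where "family_perm C \<sigma>" using family_perm_exists[OF assms] by blast
  then show ?thesis by (intro exI[of _ \<sigma>]) (auto simp: family_perm_def)
qed

lemma finite_cycle_arcs: "finite (cycle_arcs c)"
  by transfer simp

lemma hike_edges_trace_prod:
  assumes "finite C" "pairwise indep C"
  shows "hike_edges (trace_prod C) = trace_prod (edge_letter ` family_arcs C)"
  using assms
proof (induction C rule: finite_induct)
  case empty
  show ?case by (simp add: family_arcs_def hike_edges_0)
next
  case (insert c C)
  have arcs: "family_arcs (insert c C) = cycle_arcs c \<union> family_arcs C"
    by (simp add: family_arcs_def)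
  obtain \<sigma> where \<sigma>: "family_arcs (insert c C) \<subseteq> range (\<lambda>i. (i, \<sigma> i))"
    using family_arcs_graph[of "insert c C"] insert by auto
  have fst_arcs: "fst ` cycle_arcs d = cycle_verts d" for d :: "'a scycle"
  proof -
    obtain vs where vs: "d = cycle_through vs" "distinct vs" "vs \<noteq> []" by (rule scycle_cases_list)
    show ?thesis
      unfolding vs(1) cycle_arcs_through[OF vs(2,3)] cycle_verts_through[OF vs(2,3)] by (simp add: image_image)
  qed
  have "indep c d" if "d \<in> C" for d using insert that by (auto simp: pairwise_insert)
  then have "cycle_verts c \<inter> cycle_verts d = {}" if "d \<in> C" for d
    using that by (simp add: indep_scycle_def)
  then have "cycle_arcs c \<inter> family_arcs C = {}"
    unfolding family_arcs_def fst_arcs[symmetric] by blast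
  then have "edge_letter ` cycle_arcs c \<inter> edge_letter ` family_arcs C = {}"
    by (simp add: image_Int[OF inj_edge_letter, symmetric])
  moreover have "finite (family_arcs C)"
    using insert.hyps by (simp add: family_arcs_def finite_cycle_arcs)
  ultimately have "trace_prod (edge_letter ` family_arcs (insert c C))
      = trace_prod (edge_letter ` cycle_arcs c) + trace_prod (edge_letter ` family_arcs C)"
    using pairwise_indep_edge_letters[OF \<sigma>]
    unfolding arcs image_Un by (intro trace_prod_Un) (auto simp: finite_cycle_arcs)
  moreover have "trace_prod (insert c C) = gen c + trace_prod C"
    by (rule trace_prod_insert) (use insert in auto)
  moreover have "hike_edges (trace_prod C) = trace_prod (edge_letter ` family_arcs C)"
    by (rule insert.IH) (use insert.prems in \<open>auto simp: pairwise_insert\<close>)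
  ultimately show ?case by (simp add: hike_edges_plus hike_edges_gen cycle_edges_eq)
qed

text \<open>The edges of a self-avoiding hike are the letters of its product of edges, and they determine the
hike.\<close>

lemma inj_on_hike_edges: "inj_on hike_edges (self_avoiding G)"
proof (rule inj_onI)
  fix h h' assume "h \<in> self_avoiding G" "h' \<in> self_avoiding G" and eq: "hike_edges h = hike_edges h'"
  then obtain C D where C: "C \<in> disjoint_families G" "h = trace_prod C"
    and D: "D \<in> disjoint_families G" "h' = trace_prod D"
    unfolding self_avoiding_eq by blast
  have letters: "letters (hike_edges (trace_prod C)) = edge_letter ` family_arcs C"
    if "C \<in> disjoint_families G" for C
  proof -
    have "finite (family_arcs C)"
      using disjoint_familiesD(2)[OF that] by (simp add: family_arcs_def finite_cycle_arcs)
    then show ?thesis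
      using disjoint_familiesD[OF that] by (simp add: hike_edges_trace_prod letters_trace_prod)
  qed
  have "edge_letter ` family_arcs C = edge_letter ` family_arcs D"
    using letters[OF C(1)] letters[OF D(1)] eq C(2) D(2) by simp
  then have "family_arcs C = family_arcs D"
    by (simp add: inj_image_eq_iff[OF inj_edge_letter])
  then have "C = D"
    using family_arcs_inj disjoint_familiesD[OF C(1)] disjoint_familiesD[OF D(1)] by blast
  with C D show "h = h'" by simp
qed

lemma linear_to_edges: "linear_on_set UNIV to_edges"
  unfolding to_edges_def by (rule linear_lin_ext)

lemma to_edges_single: "to_edges (Poly_Mapping.single h c) = Poly_Mapping.single (hike_edges h) c"
  using linearD(2)[OF linear_to_edges, of c "basis h"] by (simp add: scale_single to_edges_def)

lemma inj_on_to_edges: "inj_on to_edges (lincombs (self_avoiding G) :: ('v hike \<Rightarrow>\<^sub>0 'k::field) set)"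
proof (rule inj_onI)
  fix x y :: "'v hike \<Rightarrow>\<^sub>0 'k"
  assume x: "x \<in> lincombs (self_avoiding G)" and y: "y \<in> lincombs (self_avoiding G)"
    and eq: "to_edges x = to_edges y"
  \<comment> \<open>Distinct self-avoiding hikes have distinct products of edges, so no coefficients are added up.\<close>
  have coeff: "Poly_Mapping.lookup (to_edges z) (hike_edges h) = Poly_Mapping.lookup z h"
    if z: "z \<in> lincombs (self_avoiding G)" and h: "h \<in> self_avoiding G" for z :: "'v hike \<Rightarrow>\<^sub>0 'k" and h
  proof -
    have "Poly_Mapping.lookup (to_edges z) (hike_edges h)
        = (\<Sum>k\<in>Poly_Mapping.keys z. if k = h then Poly_Mapping.lookup z k else 0)"
      unfolding to_edges_def lin_ext_def lookup_sum
    proof (rule sum.cong[OF refl])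
      fix k assume "k \<in> Poly_Mapping.keys z"
      then have "hike_edges k = hike_edges h \<longleftrightarrow> k = h"
        using z h inj_on_hike_edges[of G] by (auto simp: lincombs_def inj_on_def)
      then show "Poly_Mapping.lookup (scale (Poly_Mapping.lookup z k) (basis (hike_edges k))) (hike_edges h)
          = (if k = h then Poly_Mapping.lookup z k else 0)"
        by (simp add: lookup_single when_def)
    qed
    then show ?thesis by (simp add: in_keys_iff)
  qed
  show "x = y"
  proof (rule poly_mapping_eqI)
    fix h show "Poly_Mapping.lookup x h = Poly_Mapping.lookup y h"
    proof (cases "h \<in> self_avoiding G")
      case True
      then show ?thesis using coeff[OF x] coeff[OF y] eq by metis
    next
      case False
      then have "h \<notin> Poly_Mapping.keys x" "h \<notin> Poly_Mapping.keys y"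
        using x y unfolding lincombs_def by blast+
      then show ?thesis by (simp add: in_keys_iff)
    qed
  qed
qed

lemma weighted_hike_sum_in_lincombs: "weighted_hike_sum G a \<in> lincombs (self_avoiding G)"
proof -
  have "Poly_Mapping.lookup (weighted_hike_sum G a) h = 0" if "h \<notin> self_avoiding G" for h
    using that unfolding weighted_hike_sum_def self_avoiding_eq
    by (auto simp: lookup_sum lookup_single when_def intro!: sum.neutral)
  then show ?thesis unfolding lincombs_def by (auto simp: in_keys_iff)
qed

lemma as_hikes_to_edges: "as_hikes G (to_edges (weighted_hike_sum G a)) = weighted_hike_sum G a"
  unfolding as_hikes_def by (rule inv_into_f_f[OF inj_on_to_edges weighted_hike_sum_in_lincombs])

lemma sum_self_avoiding_eq: "(\<Sum>h\<in>self_avoiding G. basis h) = weighted_hike_sum G (1 :: 'k::field)"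
  unfolding weighted_hike_sum_def by (rule sum_image_families) simp

section \<open>The permanent and the determinant\<close>

text \<open>The matrix \<open>I + a W\<close>, with \<open>a = 1\<close> for the permanent and \<open>a = -1\<close> for the determinant.\<close>

definition weighted_matrix :: "'k \<Rightarrow> 'v pair_pre_digraph \<Rightarrow> 'v \<Rightarrow> 'v \<Rightarrow> ('v edge_var trace \<Rightarrow>\<^sub>0 'k::field)" where
  "weighted_matrix a G i j = (if i = j then 1 else 0)
     + (if (i, j) \<in> parcs G then Poly_Mapping.single (gen (edge_letter (i, j))) a else 0)"

lemma weighted_matrix_commute:
  assumes "i \<noteq> i'"
  shows "weighted_matrix a G i j * weighted_matrix a G i' j' = weighted_matrix a G i' j' * weighted_matrix a G i j"
proof -
  have "gen (edge_letter (i, j)) + gen (edge_letter (i', j')) = gen (edge_letter (i', j')) + gen (edge_letter (i, j))"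
    by (rule gen_commute) (use assms in \<open>simp add: edge_letter_def\<close>)
  moreover define s t where
    "s = (if (i, j) \<in> parcs G then Poly_Mapping.single (gen (edge_letter (i, j))) a else 0)"
    "t = (if (i', j') \<in> parcs G then Poly_Mapping.single (gen (edge_letter (i', j'))) a else 0)"
  ultimately have "s * t = t * s" by (simp add: mult_single)
  then show ?thesis
    unfolding weighted_matrix_def s_t_def[symmetric] by (simp add: algebra_simps)
qed

lemma row_prod_insert:
  assumes "finite V" "x \<notin> V"
  shows "row_prod (insert x V) (weighted_matrix a G) \<sigma>
    = weighted_matrix a G x (\<sigma> x) * row_prod V (weighted_matrix a G) \<sigma>"
proof -
  interpret comp_fun_commute_on UNIV "\<lambda>i. (*) (weighted_matrix a G i (\<sigma> i))"
  proof
    fix x y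
    show "(*) (weighted_matrix a G y (\<sigma> y)) \<circ> (*) (weighted_matrix a G x (\<sigma> x))
      = (*) (weighted_matrix a G x (\<sigma> x)) \<circ> (*) (weighted_matrix a G y (\<sigma> y))"
      by (cases "x = y") (auto simp: fun_eq_iff weighted_matrix_commute simp flip: mult.assoc)
  qed
  show ?thesis unfolding row_prod_def by (rule fold_insert) (use assms in auto)
qed

text \<open>Multiplying out, \<open>S\<close> is the set of rows that contribute an edge; each other row contributes the
entry \<open>1\<close> of the identity matrix, which lies on the diagonal.\<close>

lemma row_prod_expand:
  fixes \<sigma> :: "'v \<Rightarrow> 'v"
  assumes "finite V"
  shows "row_prod V (weighted_matrix a G) \<sigma>
    = (\<Sum>S | S \<subseteq> V \<and> (\<forall>i\<in>V - S. \<sigma> i = i) \<and> (\<forall>i\<in>S. (i, \<sigma> i) \<in> parcs G).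
        Poly_Mapping.single (trace_prod (edge_letter ` (\<lambda>i. (i, \<sigma> i)) ` S)) (a ^ card S))"
  using assms
proof (induction V rule: finite_induct)
  case empty
  have "{S. S \<subseteq> {} \<and> (\<forall>i\<in>{} - S. \<sigma> i = i) \<and> (\<forall>i\<in>S. (i, \<sigma> i) \<in> parcs G)} = {{}}" by auto
  then show ?case by (simp add: row_prod_def)
next
  case (insert x V)
  let ?e = "\<lambda>S. edge_letter ` (\<lambda>i. (i, \<sigma> i)) ` S"
  let ?s = "\<lambda>S. Poly_Mapping.single (trace_prod (?e S)) (a ^ card S)"
  define P where "P V = {S. S \<subseteq> V \<and> (\<forall>i\<in>V - S. \<sigma> i = i) \<and> (\<forall>i\<in>S. (i, \<sigma> i) \<in> parcs G)}" for V
  have finP: "finite (P V)" unfolding P_def using insert.hyps(1) by simp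
  have fin: "finite S" if "S \<in> P V" for S
    using that insert.hyps(1) finite_subset unfolding P_def by blast
  have notin: "x \<notin> S" if "S \<in> P V" for S using that insert.hyps(2) unfolding P_def by blast
  \<comment> \<open>The first part collects the choices of the diagonal entry in row \<open>x\<close>, the second those of an
    edge.\<close>
  have split: "P (insert x V) = (if \<sigma> x = x then P V else {})
      \<union> (if (x, \<sigma> x) \<in> parcs G then insert x ` P V else {})" (is "_ = ?A \<union> ?B")
  proof (intro equalityI subsetI)
    fix S assume S: "S \<in> P (insert x V)"
    show "S \<in> ?A \<union> ?B"
    proof (cases "x \<in> S")
      case True
      with S have "S - {x} \<in> P V" and arc: "(x, \<sigma> x) \<in> parcs G" and "S = insert x (S - {x})"
        using insert.hyps(2) unfolding P_def by auto
      from this(3,1) have "S \<in> insert x ` P V" by (rule image_eqI)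
      with arc show ?thesis by simp
    next
      case False
      with S have "S \<in> P V" "\<sigma> x = x" using insert.hyps(2) unfolding P_def by auto
      then show ?thesis by simp
    qed
  next
    fix S assume "S \<in> ?A \<union> ?B"
    then show "S \<in> P (insert x V)"
      using insert.hyps(2) unfolding P_def by (auto split: if_splits)
  qed
  have disj: "?A \<inter> ?B = {}" using notin by (auto split: if_splits)
  have step: "?s (insert x S) = Poly_Mapping.single (gen (edge_letter (x, \<sigma> x))) a * ?s S" if "S \<in> P V" for S
  proof -
    have "pairwise indep (?e (insert x S))"
      by (rule pairwise_indep_edge_letters[of _ \<sigma>]) auto
    moreover have "edge_letter (x, \<sigma> x) \<notin> ?e S"
      using notin[OF that] by (auto simp: edge_letter_def)
    ultimately have "trace_prod (?e (insert x S)) = gen (edge_letter (x, \<sigma> x)) + trace_prod (?e S)"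
      using trace_prod_insert[of "?e S" "edge_letter (x, \<sigma> x)"] fin[OF that] by simp
    then show ?thesis using fin[OF that] notin[OF that] by (simp add: mult_single)
  qed
  have inj: "inj_on (insert x) (P V)" using notin by (intro inj_onI) (metis insert_ident)
  have "row_prod (insert x V) (weighted_matrix a G) \<sigma> = weighted_matrix a G x (\<sigma> x) * (\<Sum>S\<in>P V. ?s S)"
    unfolding row_prod_insert[OF insert.hyps] insert.IH P_def ..
  also have "\<dots> = (\<Sum>S\<in>?A. ?s S) + (\<Sum>S\<in>?B. ?s S)"
  proof -
    have "(\<Sum>S\<in>insert x ` P V. ?s S) = (\<Sum>S\<in>P V. Poly_Mapping.single (gen (edge_letter (x, \<sigma> x))) a * ?s S)"
      unfolding sum.reindex[OF inj] comp_apply by (rule sum.cong[OF refl step])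
    then show ?thesis
      unfolding weighted_matrix_def distrib_right by (auto simp: sum_distrib_left)
  qed
  also have "\<dots> = (\<Sum>S\<in>P (insert x V). ?s S)"
    unfolding split by (rule sum.union_disjoint[symmetric]) (use finP disj in auto)
  finally show ?case unfolding P_def .
qed

lemma of_int_times_single:
  "of_int z * Poly_Mapping.single t c = Poly_Mapping.single (t :: 'a::monoid_add) (of_int z * c :: 'k::field)"
  by (simp add: mult_single flip: single_of_int)

lemma permutes_fixing:
  assumes "finite V" "S \<subseteq> V"
  shows "\<sigma> permutes V \<and> (\<forall>i\<in>V - S. \<sigma> i = i) \<longleftrightarrow> \<sigma> permutes S"
  using assms by (auto intro: permutes_superset permutes_subset simp: permutes_not_in)

context
  fixes G :: "'v pair_pre_digraph"
  assumes G: "pair_fin_digraph G"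
begin

interpretation pair_fin_digraph G by (rule G)

lemma disjoint_families_iff:
  "C \<in> disjoint_families G \<longleftrightarrow> family_arcs C \<subseteq> parcs G \<and> finite C \<and> pairwise indep C"
  using simple_cycles_iff[OF pair_wf_digraph_axioms]
  unfolding disjoint_families_def family_arcs_def by blast

text \<open>The terms of the expanded sum are indexed by pairs of a set \<open>S\<close> and a permutation of \<open>S\<close> moving
along edges of \<open>G\<close>, and these correspond to families of disjoint cycles. The weight \<open>w\<close> is \<open>1\<close> for
the permanent and the sign for the determinant.\<close>

lemma sum_permutations_expand:
  fixes w :: "('v \<Rightarrow> 'v) \<Rightarrow> int"
  shows "(\<Sum>\<sigma> | \<sigma> permutes pverts G. of_int (w \<sigma>) * row_prod (pverts G) (weighted_matrix a G) \<sigma>)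
    = to_edges (\<Sum>C\<in>disjoint_families G. Poly_Mapping.single (trace_prod C)
        (of_int (w (induced_perm C)) * a ^ card (family_verts C) :: 'k::field))"
proof -
  let ?V = "pverts G"
  let ?t = "\<lambda>\<sigma> S. Poly_Mapping.single (trace_prod (edge_letter ` (\<lambda>i. (i, \<sigma> i)) ` S)) (of_int (w \<sigma>) * a ^ card S)"
  let ?R = "\<lambda>\<sigma>. {S. S \<subseteq> ?V \<and> (\<forall>i\<in>?V - S. \<sigma> i = i) \<and> (\<forall>i\<in>S. (i, \<sigma> i) \<in> parcs G)}"
  have "(\<Sum>\<sigma> | \<sigma> permutes ?V. of_int (w \<sigma>) * row_prod ?V (weighted_matrix a G) \<sigma>)
      = (\<Sum>\<sigma> | \<sigma> permutes ?V. \<Sum>S\<in>?R \<sigma>. ?t \<sigma> S)"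
    unfolding row_prod_expand[OF pair_finite_verts] sum_distrib_left of_int_times_single ..
  also have "\<dots> = (\<Sum>(\<sigma>, S)\<in>Sigma {\<sigma>. \<sigma> permutes ?V} ?R. ?t \<sigma> S)"
    by (rule sum.Sigma) (use pair_finite_verts in \<open>auto simp: finite_permutations\<close>)
  also have "\<dots> = (\<Sum>C\<in>disjoint_families G. Poly_Mapping.single (hike_edges (trace_prod C))
      (of_int (w (induced_perm C)) * a ^ card (family_verts C)))"
  proof (rule sum.reindex_bij_betw[symmetric, THEN trans])
    let ?j = "\<lambda>C. (induced_perm C, family_verts C)"
    show "bij_betw ?j (disjoint_families G) (Sigma {\<sigma>. \<sigma> permutes ?V} ?R)"
    proof (rule bij_betw_imageI)
      show "inj_on ?j (disjoint_families G)"
      proof (rule inj_onI)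
        fix C D assume C: "C \<in> disjoint_families G" and D: "D \<in> disjoint_families G" and eq: "?j C = ?j D"
        note C = disjoint_familiesD(2,3)[OF C] and D = disjoint_familiesD(2,3)[OF D]
        show "C = D"
          by (rule family_arcs_inj[OF C D]) (use induced_perm[OF C] induced_perm[OF D] eq in \<open>simp add: family_perm_def\<close>)
      qed
      show "?j ` disjoint_families G = Sigma {\<sigma>. \<sigma> permutes ?V} ?R"
      proof (intro equalityI subsetI)
        fix p assume "p \<in> ?j ` disjoint_families G"
        then obtain C where p: "p = ?j C" and C: "C \<in> disjoint_families G" by blast
        have perm: "family_perm C (induced_perm C)" by (rule induced_perm[OF disjoint_familiesD(2,3)[OF C]])
        then have arcs: "(i, induced_perm C i) \<in> parcs G" if "i \<in> family_verts C" for i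
          using that C unfolding disjoint_families_iff family_perm_def by blast
        then have sub: "family_verts C \<subseteq> ?V" using in_arcsD1 by blast
        have "induced_perm C permutes ?V \<and> (\<forall>i\<in>?V - family_verts C. induced_perm C i = i)"
          unfolding permutes_fixing[OF pair_finite_verts sub] using perm by (simp add: family_perm_def)
        then show "p \<in> Sigma {\<sigma>. \<sigma> permutes ?V} ?R" using p arcs sub by blast
      next
        fix p assume "p \<in> Sigma {\<sigma>. \<sigma> permutes ?V} ?R"
        then obtain \<sigma> S where p: "p = (\<sigma>, S)" and S: "S \<subseteq> ?V" and arcs: "\<forall>i\<in>S. (i, \<sigma> i) \<in> parcs G"
          and \<sigma>: "\<sigma> permutes ?V \<and> (\<forall>i\<in>?V - S. \<sigma> i = i)" by blast
        have "\<sigma> permutes S" using \<sigma> unfolding permutes_fixing[OF pair_finite_verts S] .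
        then obtain C where C: "finite C" "pairwise indep C" "family_verts C = S" "family_perm C \<sigma>"
          using permutation_family_exists finite_subset[OF S pair_finite_verts] by blast
        have "C \<in> disjoint_families G"
          unfolding disjoint_families_iff using C arcs by (auto simp: family_perm_def)
        moreover have "induced_perm C = \<sigma>" by (rule family_perm_unique[OF induced_perm[OF C(1,2)] C(4)])
        ultimately show "p \<in> ?j ` disjoint_families G" using p C(3) by blast
      qed
    qed
    show "(\<Sum>C\<in>disjoint_families G. (case ?j C of (\<sigma>, S) \<Rightarrow> ?t \<sigma> S))
      = (\<Sum>C\<in>disjoint_families G. Poly_Mapping.single (hike_edges (trace_prod C))
          (of_int (w (induced_perm C)) * a ^ card (family_verts C)))"
    proof (rule sum.cong[OF refl])
      fix C assume "C \<in> disjoint_families G"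
      note C = disjoint_familiesD(2,3)[OF this]
      have "family_arcs C = (\<lambda>i. (i, induced_perm C i)) ` family_verts C"
        using induced_perm[OF C] by (simp add: family_perm_def)
      then show "(case ?j C of (\<sigma>, S) \<Rightarrow> ?t \<sigma> S) = Poly_Mapping.single (hike_edges (trace_prod C))
          (of_int (w (induced_perm C)) * a ^ card (family_verts C))"
        by (simp add: hike_edges_trace_prod[OF C])
    qed
  qed
  finally show ?thesis by (simp add: linear_sum[OF linear_to_edges] to_edges_single)
qed

lemma perm_I_plus_W_eq: "perm_I_plus_W G = to_edges (weighted_hike_sum G (1 :: 'k::field))"
proof -
  have "(\<lambda>i j. id_matrix i j + adj_matrix G i j) = weighted_matrix (1 :: 'k) G"
    by (simp add: fun_eq_iff id_matrix_def adj_matrix_def weighted_matrix_def edge_letter_def)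
  then show ?thesis
    using sum_permutations_expand[of "\<lambda>_. 1" "1 :: 'k"]
    by (simp add: perm_I_plus_W_def perm_on_def weighted_hike_sum_def)
qed

lemma det_I_minus_W_eq: "det_I_minus_W G = to_edges (weighted_hike_sum G (- 1 :: 'k::field))"
proof -
  have "(\<lambda>i j. id_matrix i j - adj_matrix G i j) = weighted_matrix (- 1 :: 'k) G"
    by (simp add: fun_eq_iff id_matrix_def adj_matrix_def weighted_matrix_def edge_letter_def single_uminus)
  moreover have "of_int (sign (induced_perm C)) * (- 1) ^ card (family_verts C) = (- 1 :: 'k) ^ card C"
    if "C \<in> disjoint_families G" for C
  proof -
    have "of_int (sign (induced_perm C) * (- 1) ^ card (family_verts C)) = (of_int ((- 1) ^ card C) :: 'k)"
      using induced_perm[OF disjoint_familiesD(2,3)[OF that]] by (simp only: family_perm_def)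
    then show ?thesis by simp
  qed
  ultimately show ?thesis
    using sum_permutations_expand[of sign "- 1 :: 'k"]
    by (simp add: det_I_minus_W_def det_on_def weighted_hike_sum_def cong: sum.cong)
qed

end

section \<open>Logarithms of self-avoiding hikes\<close>

theorem theorem4p2:
  fixes G :: "'v pair_pre_digraph"
  assumes "pair_fin_digraph G"
  shows
    "(\<forall>f :: ('v hike \<Rightarrow>\<^sub>0 'k::field_char_0) \<Rightarrow> 'v hike \<Rightarrow>\<^sub>0 'k. coalgebra_map G f \<longrightarrow>
        conv_log f ` lincombs (self_avoiding G) \<subseteq> lincombs (primes G))
   \<and> projector_onto (lincombs (self_avoiding G)) (lincombs (primes G))
        (conv_log (id :: ('v hike \<Rightarrow>\<^sub>0 'k) \<Rightarrow> 'v hike \<Rightarrow>\<^sub>0 'k))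
   \<and> (\<forall>h\<in>self_avoiding G. conv_log id (basis h :: 'v hike \<Rightarrow>\<^sub>0 'k) = (if h \<in> primes G then basis h else 0))
   \<and> star_log (\<Sum>h\<in>self_avoiding G. basis h :: 'v hike \<Rightarrow>\<^sub>0 'k) = (\<Sum>p\<in>primes G. basis p)
   \<and> inj_on to_edges (lincombs (self_avoiding G) :: ('v hike \<Rightarrow>\<^sub>0 'k) set)
   \<and> (perm_I_plus_W G :: 'v edge_var trace \<Rightarrow>\<^sub>0 'k) \<in> to_edges ` lincombs (self_avoiding G)
   \<and> (det_I_minus_W G :: 'v edge_var trace \<Rightarrow>\<^sub>0 'k) \<in> to_edges ` lincombs (self_avoiding G)
   \<and> star_log (as_hikes G (perm_I_plus_W G)) = (prime_sum G :: 'v hike \<Rightarrow>\<^sub>0 'k)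
   \<and> - star_log (as_hikes G (det_I_minus_W G)) = (prime_sum G :: 'v hike \<Rightarrow>\<^sub>0 'k)"
proof (intro conjI allI impI ballI image_subsetI)
  note fin = finite_simple_cycles[OF assms]
  fix f :: "('v hike \<Rightarrow>\<^sub>0 'k) \<Rightarrow> 'v hike \<Rightarrow>\<^sub>0 'k" and x :: "'v hike \<Rightarrow>\<^sub>0 'k"
  assume f: "coalgebra_map G f" and x: "x \<in> lincombs (self_avoiding G)"
  then have "f x \<in> lincombs (self_avoiding G)" by (simp add: coalgebra_map_def)
  then show "conv_log f x \<in> lincombs (primes G)"
    unfolding conv_log_coalgebra_map[OF f x] by (rule conv_log_id_in_primes[OF fin])
next
  note fin = finite_simple_cycles[OF assms]
  note log = star_log_weighted_hike_sum[OF fin]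
  show "projector_onto (lincombs (self_avoiding G)) (lincombs (primes G))
      (conv_log (id :: ('v hike \<Rightarrow>\<^sub>0 'k) \<Rightarrow> 'v hike \<Rightarrow>\<^sub>0 'k))"
    by (rule projector_onto_primes[OF fin])
  show "conv_log id (basis h :: 'v hike \<Rightarrow>\<^sub>0 'k) = (if h \<in> primes G then basis h else 0)"
    if "h \<in> self_avoiding G" for h
    using that by (subst conv_log_id[OF fin]) (auto simp: lincombs_def)
  show "star_log (\<Sum>h\<in>self_avoiding G. basis h :: 'v hike \<Rightarrow>\<^sub>0 'k) = (\<Sum>p\<in>primes G. basis p)"
    unfolding sum_self_avoiding_eq log by (simp add: prime_sum_def)
  show "inj_on to_edges (lincombs (self_avoiding G) :: ('v hike \<Rightarrow>\<^sub>0 'k) set)"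
    by (rule inj_on_to_edges)
  show "(perm_I_plus_W G :: 'v edge_var trace \<Rightarrow>\<^sub>0 'k) \<in> to_edges ` lincombs (self_avoiding G)"
    unfolding perm_I_plus_W_eq[OF assms] by (rule imageI[OF weighted_hike_sum_in_lincombs])
  show "(det_I_minus_W G :: 'v edge_var trace \<Rightarrow>\<^sub>0 'k) \<in> to_edges ` lincombs (self_avoiding G)"
    unfolding det_I_minus_W_eq[OF assms] by (rule imageI[OF weighted_hike_sum_in_lincombs])
  show "star_log (as_hikes G (perm_I_plus_W G)) = (prime_sum G :: 'v hike \<Rightarrow>\<^sub>0 'k)"
    unfolding perm_I_plus_W_eq[OF assms] as_hikes_to_edges log by simp
  show "- star_log (as_hikes G (det_I_minus_W G)) = (prime_sum G :: 'v hike \<Rightarrow>\<^sub>0 'k)"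
    unfolding det_I_minus_W_eq[OF assms] as_hikes_to_edges log by (simp add: scale_minus_one)
qed

end
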